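(* Let $c\in\mathbb{C}$, $c\neq0$, let $g$ be an entire function and $f$ a nonconstant meromorphic function on $\mathbb{C}$, and let $n\geq2$, $m\geq3$ be integers with $(n,m)\neq(3,3)$. Then $f$ is a solution of $$f^n(z)+f^m(z+c)=e^{g(z)}$$ if and only if $f(z)=Ae^{g(z)/n}$ and $$g(z+c)=\frac nm\,g(z)+n\,\mathrm{Ln}\frac BA,$$ where $A,B$ are two nonzero constants with $A^n+B^m=1$. In particular, if the order of $g$ is less than $1$, then the nonconstant meromorphic function $f$ is a solution of this equation if and only if $n=m$, $g(z)=\alpha z+\beta$ and $f(z)=Ae^{\frac{\alpha z+\beta}{n}}$ for some constants $\alpha\neq0$, $\beta$, $A$ with $A^n(1+e^{\alpha c})=1$.
   Context: Meromorphic and entire functions are on the whole complex plane $\mathbb{C}$; $f^n(z)$ means $(f(z))^n$. $\mathrm{Ln}\,w$ denotes the multivalued complex logarithm, i.e. $\mathrm{Ln}\frac BA$ stands for some complex number $\ell$ with $e^{\ell}=B/A$. The order of a meromorphic function $g$ is $\rho(g)=\limsup_{r\to+\infty}\frac{\log T(r,g)}{\log r}$, where $T(r,g)$ is the Nevanlinna characteristic function of $g$. *)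

theory Defs
  imports "HOL-Complex_Analysis.Complex_Analysis" "HOL-Library.Extended_Real"
    "HOL-Library.Liminf_Limsup"
begin

definition log_plus :: "real \<Rightarrow> real" where
  "log_plus x = max 0 (ln x)"

definition nev_proximity :: "real \<Rightarrow> (complex \<Rightarrow> complex) \<Rightarrow> real" where
  "nev_proximity r f =
     1 / (2 * pi) * integral {0..2 * pi} (\<lambda>\<theta>. log_plus (norm (f (of_real r * cis \<theta>))))"

(* Poles in the closed disc of radius t, counted with multiplicity; at a pole, zorder is minus
   the multiplicity. *)
definition nev_pole_count :: "real \<Rightarrow> (complex \<Rightarrow> complex) \<Rightarrow> real" where
  "nev_pole_count t f = (\<Sum>z | is_pole f z \<and> norm z \<le> t. real_of_int (- zorder f z))"

definition nev_counting :: "real \<Rightarrow> (complex \<Rightarrow> complex) \<Rightarrow> real" where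
  "nev_counting r f =
     integral {0..r} (\<lambda>t. (nev_pole_count t f - nev_pole_count 0 f) / t)
     + nev_pole_count 0 f * ln r"

definition nev_characteristic :: "real \<Rightarrow> (complex \<Rightarrow> complex) \<Rightarrow> real" where
  "nev_characteristic r f = nev_proximity r f + nev_counting r f"

(* If the characteristic vanishes identically (a constant of modulus at most 1), the convention
   ln 0 = 0 yields order 0, the usual order of a constant. *)
definition nev_order :: "(complex \<Rightarrow> complex) \<Rightarrow> ereal" where
  "nev_order f = Limsup at_top (\<lambda>r. ereal (ln (nev_characteristic r f) / ln r))"

(* Equality of meromorphic functions: a pole of f is stored with the junk value 0, so the
   pointwise identity is required exactly where neither summand has a pole. By continuity this
   determines the identity on the whole plane. *)
definition solves_fermat_shift ::
    "nat \<Rightarrow> nat \<Rightarrow> complex \<Rightarrow> (complex \<Rightarrow> complex) \<Rightarrow> (complex \<Rightarrow> complex) \<Rightarrow> bool" where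
  "solves_fermat_shift n m c g f \<longleftrightarrow>
     (\<forall>z. \<not> is_pole f z \<and> \<not> is_pole f (z + c) \<longrightarrow> f z ^ n + f (z + c) ^ m = exp (g z))"

end

theory Submission
  imports Defs
begin

text \<open>
Put \<open>F z = f z * exp (- g z / n)\<close> and \<open>G z = f (z + c) * exp (- g z / m)\<close>. The equation
says \<open>F ^ n + G ^ m = 1\<close>: the pair \<open>(F, G)\<close> maps the plane into a curve of Fermat type. The
heart of the matter is that this map is constant. Once \<open>F = A\<close> and \<open>G = B\<close>, the identity
\<open>A * exp (g (z + c) / n) = f (z + c) = B * exp (g z / m)\<close> shows that
\<open>g (z + c) / n - g z / m\<close> is an entire function with constant exponential \<open>B / A\<close>, hence a
constant, and this is the asserted functional equation for \<open>g\<close>. The converse is a computation.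

For \<open>n \<noteq> m\<close> the solution \<open>f\<close> has no poles: a pole of order \<open>p\<close> at \<open>z\<close> forces a pole of order
\<open>p * n / m\<close> at \<open>z + c\<close>, and walking from pole to pole, in the direction in which the orders
decrease, would never end (\<open>no_zeros_if_orders_scale\<close>, applied to a denominator of \<open>f\<close>). So \<open>F\<close>
and \<open>G\<close> are entire. The factors \<open>G - \<omega>\<close> of \<open>G ^ m - 1 = - F ^ n\<close> have no common zeros, so each of
them is an \<open>n\<close>-th power of an entire function. Since \<open>m \<ge> 3\<close> there are enough of them to produce
zero-free linear combinations whose ratios omit two values, and Picard's little theorem makes
everything constant (\<open>entire_fermat_constant\<close>).

For \<open>n = m\<close> poles are possible, but the excluded pair leaves \<open>n \<ge> 4\<close>, where the curve
\<open>a ^ n + b ^ n = q ^ n\<close> has genus at least three. Its hyperbolicity is made explicit in the manner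
of Ahlfors. Writing \<open>F = a / q\<close> and \<open>G = b / q\<close> with entire \<open>a, b, q\<close>, the three Wronskians of
\<open>a, b, q\<close> are, up to sign, one entire function \<open>\<psi>\<close> times the powers \<open>a ^ (n-1)\<close>, \<open>b ^ (n-1)\<close>,
\<open>q ^ (n-1)\<close>. With \<open>N = |a|^2 + |b|^2 + |q|^2\<close>, the density \<open>|\<psi>|^2 * N ^ (n-3)\<close> has curvature
bounded above by a negative constant, because the Laplacian of \<open>ln N\<close> is, up to a factor, the sum
of the squared Wronskians divided by \<open>N ^ 2\<close>. Comparison with the hyperbolic metric of large discs
gives \<open>\<psi> = 0\<close> (\<open>ahlfors_schwarz\<close>), so the ratios \<open>a / q\<close> and \<open>b / q\<close> are constant
(\<open>fermat_triple_wronskian_zero\<close>, \<open>wronskian_zero_imp_proportional\<close>).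

If \<open>g\<close> has order less than one, then \<open>T(r, g) = o(r)\<close>. After subtracting a linear function
(\<open>n = m\<close>) or a fixed point of the affine map (\<open>n \<noteq> m\<close>), the functional equation makes \<open>g\<close>
periodic up to a factor, so that a single zero propagates along a whole progression of step \<open>c\<close>.
So many zeros force linear growth of \<open>T\<close> (\<open>slow_entire_zero_progression\<close>), unless the function
vanishes. A function without zeros is \<open>exp h\<close>, and slow growth kills all higher Taylor coefficients
of \<open>h\<close> (\<open>slow_exp_imp_constant\<close>). Hence \<open>g\<close> is linear, and \<open>n = m\<close> because \<open>f\<close> is not constant
(\<open>slow_entire_affine_shift\<close>).
\<close>

section \<open>Identities and orders of entire functions\<close>

lemma entire_eventually_nonzero:
  assumes "f holomorphic_on UNIV" "f w \<noteq> 0"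
  shows "eventually (\<lambda>z. f z \<noteq> 0) (at z)"
  using non_zero_neighbour_alt[of f UNIV z w] assms by (auto simp: connected_UNIV)

lemma entire_analytic_at: "f holomorphic_on UNIV \<Longrightarrow> f analytic_on {z}"
  by (simp add: analytic_on_holomorphic) blast

lemma entire_zorder_power:
  assumes "f holomorphic_on UNIV" "f w \<noteq> 0"
  shows "zorder (\<lambda>z. f z ^ n) z = int n * zorder f z"
  by (rule zorder_power)
     (use assms entire_eventually_nonzero[of f w z] in
       \<open>auto intro: analytic_on_imp_meromorphic_on entire_analytic_at eventually_frequently\<close>)

lemma entire_eq_zero_off_zeros:
  fixes D q :: "complex \<Rightarrow> complex"
  assumes hol: "D holomorphic_on UNIV" "q holomorphic_on UNIV" and w: "q w \<noteq> 0"
    and eq: "\<And>z. q z \<noteq> 0 \<Longrightarrow> D z = 0"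
  shows "D z = 0"
proof (rule ccontr)
  assume "D z \<noteq> 0"
  then have "eventually (\<lambda>z. D z \<noteq> 0) (at z)" by (rule entire_eventually_nonzero[OF hol(1)])
  then have "eventually (\<lambda>_. False) (at z)"
    using entire_eventually_nonzero[OF hol(2) w, of z] by eventually_elim (use eq in blast)
  then show False by simp
qed

lemma holomorphic_on_translate:
  assumes "f holomorphic_on UNIV"
  shows "(\<lambda>z. f (z + c)) holomorphic_on UNIV"
proof -
  have "(f \<circ> (\<lambda>z. z + c)) holomorphic_on UNIV"
    by (rule holomorphic_on_compose_gen[of _ _ _ UNIV]) (use assms in \<open>auto intro: holomorphic_intros\<close>)
  then show ?thesis by (simp add: o_def)
qed

lemma zorder_translate: "zorder (\<lambda>u. f (u + c)) z = zorder f (z + c)"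
  by (subst (1 2) zorder_shift) (simp add: add.assoc)

lemma entire_exp_constant_imp_constant:
  fixes \<phi> :: "complex \<Rightarrow> complex"
  assumes hol: "\<phi> holomorphic_on UNIV" and e: "\<And>z. exp (\<phi> z) = K"
  shows "\<phi> z = \<phi> 0"
proof -
  have "(\<phi> has_field_derivative 0) (at z)" for z
  proof -
    have d: "(\<phi> has_field_derivative deriv \<phi> z) (at z)" using hol holomorphic_derivI by blast
    have "((\<lambda>z. exp (\<phi> z)) has_field_derivative exp (\<phi> z) * deriv \<phi> z) (at z)"
      by (auto intro!: derivative_eq_intros d)
    moreover have "((\<lambda>z. exp (\<phi> z)) has_field_derivative 0) (at z)" unfolding e by simp
    ultimately have "exp (\<phi> z) * deriv \<phi> z = 0" by (rule DERIV_unique)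
    then show ?thesis using d by simp
  qed
  then obtain k where "\<And>z. z \<in> UNIV \<Longrightarrow> \<phi> z = k"
    using has_field_derivative_zero_constant[of UNIV \<phi>] by auto
  then show ?thesis by simp
qed

section \<open>Entire solutions of a Fermat equation\<close>

text \<open>
Where \<open>H\<close> vanishes \<open>R\<close> does not, so the zero of \<open>H\<close> has order \<open>n\<close> times that of the zero of \<open>F\<close>.
Weierstrass' theorem, applied to \<open>F\<close> on the complement of the zeros of \<open>R\<close>, provides an entire
function \<open>f\<close> that keeps exactly those zeros of \<open>F\<close> where \<open>H\<close> vanishes. Then \<open>H / f ^ n\<close> is zero-free, and a
zero-free entire function has roots of every degree.
\<close>
lemma entire_coprime_factor_nth_root:
  fixes H R F :: "complex \<Rightarrow> complex"
  assumes hol: "H holomorphic_on UNIV" "R holomorphic_on UNIV" "F holomorphic_on UNIV"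
    and n: "n \<ge> 1" and eq: "\<And>z. H z * R z = F z ^ n"
    and cop: "\<And>z. H z = 0 \<Longrightarrow> R z \<noteq> 0" and nz: "F w \<noteq> 0"
  obtains E where "E holomorphic_on UNIV" "\<And>z. E z ^ n = H z"
proof -
  have nzHR: "H w \<noteq> 0" "R w \<noteq> 0" using eq[of w] nz by auto
  define A where "A = UNIV - {z. R z = 0}"
  have Rsp: "{z. R z = 0} sparse_in UNIV"
    unfolding sparse_in_open[OF open_UNIV] islimpt_iff_eventually
    using entire_eventually_nonzero[OF hol(2) nzHR(2)] by simp
  have A: "open A" "connected A" unfolding A_def
    using Rsp by (auto intro!: open_diff_sparse_pts sparse_imp_connected simp: connected_UNIV)
  have Hz: "z \<in> A \<and> F z = 0 \<longleftrightarrow> H z = 0" for z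
  proof -
    have "F z = 0 \<longleftrightarrow> H z * R z = 0" unfolding eq using n by simp
    then show ?thesis using cop[of z] unfolding A_def by auto
  qed
  have lim: "\<not> z islimpt {w\<in>A. F w = 0}" if "z \<in> frontier A" for z
  proof
    assume "z islimpt {w\<in>A. F w = 0}"
    then have "z islimpt {w. H w = 0}" by (simp add: Hz)
    then show False using entire_eventually_nonzero[OF hol(1) nzHR(1), of z] by (simp add: islimpt_iff_eventually)
  qed
  obtain h f where hf: "f holomorphic_on UNIV"
    "\<forall>z. f z = 0 \<longleftrightarrow> (\<forall>z\<in>A. F z = 0) \<or> (z \<in> A \<and> F z = 0)" "\<forall>z\<in>A. zorder f z = zorder F z"
    using weierstrass_factorization[OF holomorphic_on_subset[OF hol(3) subset_UNIV] A lim] by metis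
  have wA: "w \<in> A" using nzHR A_def by simp
  have fz: "f z = 0 \<longleftrightarrow> H z = 0" for z using hf(2) Hz wA nz by metis
  have zo: "zorder (\<lambda>z. f z ^ n) z = zorder H z" for z
  proof (cases "H z = 0")
    case True
    then have zA: "z \<in> A" using Hz by blast
    have "zorder (\<lambda>z. f z ^ n) z = int n * zorder F z"
      using entire_zorder_power[OF hf(1), of w n z] fz nzHR hf(3) zA by simp
    also have "\<dots> = zorder (\<lambda>z. H z * R z) z"
      unfolding eq using entire_zorder_power[OF hol(3) nz] by simp
    also have "\<dots> = zorder H z + zorder R z"
      using entire_eventually_nonzero[OF hol(3) nz, of z] n
      by (intro zorder_times_analytic entire_analytic_at hol) (simp add: eq)
    also have "zorder R z = 0"
      using cop[OF True] zorder_eq_0I[OF entire_analytic_at[OF hol(2)]] by simp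
    finally show ?thesis by simp
  next
    case False
    then have "f z ^ n \<noteq> 0" using fz[of z] by simp
    then show ?thesis
      using False zorder_eq_0I[OF entire_analytic_at[OF hol(1)]]
        zorder_eq_0I[OF entire_analytic_at[OF holomorphic_on_power[OF hf(1), of n]]] by simp
  qed
  obtain k where k: "k holomorphic_on UNIV" "\<And>z. k z \<noteq> 0" "\<And>z. H z = k z * f z ^ n"
    using holomorphic_zorder_factorization[of H UNIV "\<lambda>z. f z ^ n"] hol(1) hf(1) fz zo n
    by (auto simp: connected_UNIV intro: holomorphic_intros)
  obtain l where l: "l holomorphic_on UNIV" "\<And>z. k z = exp (l z)"
    using contractible_imp_holomorphic_log[of k UNIV] k by auto
  show ?thesis
  proof
    show "(\<lambda>z. f z * exp (l z / of_nat n)) holomorphic_on UNIV"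
      using n by (intro holomorphic_intros hf l) auto
    show "(f z * exp (l z / of_nat n)) ^ n = H z" for z
      using n by (simp add: power_mult_distrib k l mult.commute flip: exp_of_nat_mult)
  qed
qed

text \<open>
Picard's little theorem for \<open>u / v\<close>, which omits \<open>0\<close> and \<open>\<kappa>\<close>, in a form free of division.
\<close>
lemma entire_ratio_constant:
  fixes u v :: "complex \<Rightarrow> complex"
  assumes hol: "u holomorphic_on UNIV" "v holomorphic_on UNIV"
    and nz: "\<And>z. u z \<noteq> 0" "\<And>z. v z \<noteq> 0" "\<And>z. u z \<noteq> \<kappa> * v z" and "\<kappa> \<noteq> 0"
  obtains t where "\<And>z. u z = t * v z"
proof -
  have "(\<lambda>z. u z / v z) holomorphic_on UNIV" by (intro holomorphic_intros hol) (use nz in auto)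
  moreover have "range (\<lambda>z. u z / v z) \<inter> {0, \<kappa>} = {}"
  proof -
    have "u z / v z \<noteq> \<kappa>" for z using nz(2)[of z] nz(3)[of z] by (auto simp: nonzero_divide_eq_eq)
    then show ?thesis using nz by auto
  qed
  ultimately obtain t where "(\<lambda>z. u z / v z) = (\<lambda>_. t)"
    using little_Picard[of "\<lambda>z. u z / v z" 0 \<kappa>] assms(6) by metis
  then have "u z = t * v z" for z using nz(2)[of z] by (metis nonzero_eq_divide_eq)
  then show ?thesis by (rule that)
qed

lemma entire_power_constant:
  fixes b :: "complex \<Rightarrow> complex"
  assumes "continuous_on UNIV b" "n \<ge> 1" "\<And>z. b z ^ n = K"
  shows "b constant_on UNIV"
proof (rule continuous_finite_range_constant)
  have "range b \<subseteq> {x. x ^ n = K}" using assms by auto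
  moreover have "finite {x. x ^ n = K}" using assms(2) by (intro finite_nth_roots) auto
  ultimately show "finite (range b)" by (rule finite_subset)
qed (use assms in \<open>auto simp: connected_UNIV\<close>)

text \<open>
The factors \<open>a - \<xi> * b\<close> of \<open>a ^ n - b ^ n\<close>, with \<open>\<xi> ^ n = 1\<close>, have no zeros. Any three of them are linearly
dependent, so if \<open>n \<ge> 3\<close> a ratio of two of them omits two values. It is constant, \<open>a\<close> and \<open>b\<close> are
proportional, and then so is \<open>b ^ n\<close> to the constant \<open>K\<close>.
\<close>
lemma entire_power_diff_constant:
  fixes a b :: "complex \<Rightarrow> complex"
  assumes hol: "a holomorphic_on UNIV" "b holomorphic_on UNIV"
    and n: "n \<ge> 3" and K: "K \<noteq> 0" and eq: "\<And>z. a z ^ n - b z ^ n = K"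
  shows "b constant_on UNIV"
proof -
  define \<zeta> where "\<zeta> = cis (2 * pi / real n)"
  have "\<zeta> ^ n = cis (real n * (2 * pi / real n))" unfolding \<zeta>_def by (rule Complex.DeMoivre)
  then have zn: "\<zeta> ^ n = 1" using n by simp
  have inj: "\<zeta> \<noteq> 1" "\<zeta> ^ 2 \<noteq> 1"
  proof -
    have "inj_on (\<lambda>k. cis (2 * pi * real k / real n)) {..<n}"
      using Complex.bij_betw_roots_unity[of n] n by (auto simp: bij_betw_def)
    then have "cis (2 * pi * real k / real n) \<noteq> cis (2 * pi * real 0 / real n)" if "k < n" "k > 0" for k
      using inj_onD[of _ "{..<n}" k 0] that by (metis gr_implies_not_zero lessThan_iff not_gr_zero)
    from this[of 1] this[of 2] show "\<zeta> \<noteq> 1" "\<zeta> ^ 2 \<noteq> 1"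
      using n by (simp_all add: \<zeta>_def Complex.DeMoivre mult.commute)
  qed
  have nv: "a z \<noteq> \<xi> * b z" if "\<xi> ^ n = 1" for \<xi> z
    using eq[of z] K that by (auto simp: power_mult_distrib)
  have "\<zeta> \<noteq> -1" using inj(2) by auto
  then have "1 + \<zeta> \<noteq> 0" by (metis add_eq_0_iff2 minus_minus add.commute)
  have "\<zeta> \<noteq> 0" by (simp add: \<zeta>_def)
  \<comment> \<open>The relation \<open>(1 + \<zeta>) * (a - \<zeta> * b) = (a - \<zeta>^2 * b) + \<zeta> * (a - b)\<close> supplies the omitted value \<open>\<zeta> / (1 + \<zeta>)\<close>.\<close>
  obtain t where t: "\<And>z. a z - \<zeta> * b z = t * (a z - b z)"
  proof (rule entire_ratio_constant[of "\<lambda>z. a z - \<zeta> * b z" "\<lambda>z. a z - b z" "\<zeta> / (1 + \<zeta>)"])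
    show "a z - \<zeta> * b z \<noteq> 0" for z using nv[OF zn, of z] by simp
    show "a z - b z \<noteq> 0" for z using nv[of 1 z] by simp
    show "a z - \<zeta> * b z \<noteq> \<zeta> / (1 + \<zeta>) * (a z - b z)" for z
    proof
      assume "a z - \<zeta> * b z = \<zeta> / (1 + \<zeta>) * (a z - b z)"
      then have "(1 + \<zeta>) * (a z - \<zeta> * b z) = \<zeta> * (a z - b z)" using \<open>1 + \<zeta> \<noteq> 0\<close> by simp
      then have "a z = \<zeta>^2 * b z" by (simp add: algebra_simps power2_eq_square)
      moreover have "(\<zeta>^2) ^ n = 1" by (metis zn power_mult mult.commute power_one)
      ultimately show False using nv by blast
    qed
  qed (use \<open>\<zeta> \<noteq> 0\<close> \<open>1 + \<zeta> \<noteq> 0\<close> in \<open>auto intro!: holomorphic_intros hol\<close>)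
  have cont: "continuous_on UNIV b" using hol holomorphic_on_imp_continuous_on by blast
  show ?thesis
  proof (cases "t = 1")
    case True
    then have "b z = 0" for z using t[of z] inj by simp
    then show ?thesis by (auto simp: constant_on_def)
  next
    case False
    define s where "s = (\<zeta> - t) / (1 - t)"
    have ab: "a z = s * b z" for z
    proof -
      have "(1 - t) * a z = (\<zeta> - t) * b z" using t[of z] by (simp add: algebra_simps)
      then show ?thesis using False unfolding s_def by (simp add: field_simps)
    qed
    have e: "(s ^ n - 1) * b z ^ n = K" for z using eq[of z] unfolding ab by (simp add: algebra_simps power_mult_distrib)
    then have "s ^ n - 1 \<noteq> 0" using K by force
    then have "b z ^ n = K / (s ^ n - 1)" for z using e[of z] by (simp add: field_simps)
    then show ?thesis by (intro entire_power_constant[OF cont, of n]) (use n in auto)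
  qed
qed

text \<open>
A difference of two squares has only two factors, so for \<open>n = 2\<close> a third square is needed. The six
functions \<open>a \<plusminus> b\<close>, \<open>a \<plusminus> d\<close>, \<open>b \<plusminus> d\<close> have no zeros, and the difference of \<open>a + b\<close> and \<open>a + d\<close>, or of
\<open>b + d\<close> and \<open>a + d\<close>, is again one of them. So \<open>a + b\<close> and \<open>b + d\<close> are constant multiples of
\<open>a + d\<close>, and \<open>a ^ 2 - b ^ 2 = K\<close> makes \<open>(a + d) ^ 2\<close> constant.
\<close>
lemma entire_three_squares_constant:
  fixes a b d :: "complex \<Rightarrow> complex"
  assumes hol: "a holomorphic_on UNIV" "b holomorphic_on UNIV" "d holomorphic_on UNIV"
    and eq: "\<And>z. a z ^ 2 - b z ^ 2 = K" "\<And>z. a z ^ 2 - d z ^ 2 = L" 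
    and K: "K \<noteq> 0" "L \<noteq> 0" "K \<noteq> L"
  shows "a constant_on UNIV"
proof -
  have f: "(a z + b z) * (a z - b z) = K" "(a z + d z) * (a z - d z) = L" "(b z + d z) * (b z - d z) = L - K" for z
    using eq[of z] by (auto simp: algebra_simps power2_eq_square)
  have nz: "a z + b z \<noteq> 0" "a z - b z \<noteq> 0" "a z + d z \<noteq> 0" "a z - d z \<noteq> 0" "b z + d z \<noteq> 0" "b z - d z \<noteq> 0" for z
    using f[of z] K by auto
  obtain t where t: "\<And>z. a z + b z = t * (a z + d z)"
    by (rule entire_ratio_constant[of "\<lambda>z. a z + b z" "\<lambda>z. a z + d z" 1]) (use nz in \<open>auto intro!: holomorphic_intros hol\<close>)
  have nz': "a z \<noteq> b z" for z using nz(2)[of z] by auto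
  obtain s where s: "\<And>z. b z + d z = s * (a z + d z)"
    by (rule entire_ratio_constant[of "\<lambda>z. b z + d z" "\<lambda>z. a z + d z" 1]) (use nz not_sym[OF nz'] in \<open>auto intro!: holomorphic_intros hol\<close>)
  define e where "e = (\<lambda>z. a z + d z)"
  define \<alpha> \<beta> where "\<alpha> = (t - s + 1) / 2" and "\<beta> = (t + s - 1) / 2"
  have ae: "a z = \<alpha> * e z" "b z = \<beta> * e z" for z
  proof -
    have h: "a z + b z = t * e z" "b z + d z = s * e z" "a z + d z = e z"
      using t[of z] s[of z] by (simp_all add: e_def)
    have "2 * a z = (a z + b z) - (b z + d z) + (a z + d z)" by simp
    also have "\<dots> = (t - s + 1) * e z" unfolding h by (simp add: algebra_simps)
    finally show "a z = \<alpha> * e z" by (simp add: \<alpha>_def \<beta>_def mult.commute)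
    have "2 * b z = (a z + b z) + (b z + d z) - (a z + d z)" by simp
    also have "\<dots> = (t + s - 1) * e z" unfolding h by (simp add: algebra_simps)
    finally show "b z = \<beta> * e z" by (simp add: \<alpha>_def \<beta>_def mult.commute)
  qed
  define c where "c = \<alpha>^2 - \<beta>^2"
  have ce: "c * e z ^ 2 = K" for z
    using eq(1)[of z] unfolding ae c_def by (simp only: power_mult_distrib left_diff_distrib)
  then have c: "c \<noteq> 0" using K by force
  have "e z ^ 2 = K / c" for z using ce[of z] c by (metis nonzero_mult_div_cancel_left)
  then have "a z ^ 2 = \<alpha>^2 * (K / c)" for z unfolding ae(1)[of z] by (simp add: power_mult_distrib)
  then show ?thesis using entire_power_constant[of a 2] hol holomorphic_on_imp_continuous_on by auto
qed

text \<open>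
At the points where \<open>G\<close> takes an \<open>m\<close>-th root of unity \<open>\<omega>\<close> as its value, it does so with multiplicity
divisible by \<open>n\<close>. Three such totally ramified values, besides the omitted value \<open>\<infinity>\<close>, are
too many for a nonconstant entire function; the \<open>n\<close>-th roots of \<open>G - \<omega>\<close> reduce this
fact to Picard's theorem.
\<close>
lemma entire_fermat_constant:
  fixes F G :: "complex \<Rightarrow> complex"
  assumes hol: "F holomorphic_on UNIV" "G holomorphic_on UNIV" and n: "n \<ge> 2" and m: "m \<ge> 3"
    and eq: "\<And>z. F z ^ n + G z ^ m = 1"
  shows "F constant_on UNIV \<and> G constant_on UNIV"
proof -
  have contF: "continuous_on UNIV F" and contG: "continuous_on UNIV G"
    using hol holomorphic_on_imp_continuous_on by blast+
  have "G constant_on UNIV"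
  proof (cases "\<exists>w. F w \<noteq> 0")
    case False
    then have "G z ^ m = 1" for z using eq[of z] n False by (simp add: power_0_left)
    then show ?thesis using entire_power_constant[OF contG, of m 1] m by auto
  next
    case True
    then obtain w where w: "F w \<noteq> 0" by blast
    define \<omega> where "\<omega> = (\<lambda>k. cis (2 * pi * real k / real m))"
    have om: "\<omega> k ^ m = 1" for k
    proof -
      have "\<omega> k ^ m = cis (2 * pi * real k)" unfolding \<omega>_def Complex.DeMoivre using m by simp
      then show ?thesis by (simp add: cis_multiple_2pi)
    qed
    have inj: "inj_on \<omega> {..<m}" using Complex.bij_betw_roots_unity[of m] m by (auto simp: bij_betw_def \<omega>_def)
    have ne: "\<omega> 0 \<noteq> \<omega> 1" "\<omega> 0 \<noteq> \<omega> 2" "\<omega> 1 \<noteq> \<omega> 2"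
      using m by (auto dest!: inj_onD[OF inj])
    have root: "\<exists>E. E holomorphic_on UNIV \<and> (\<forall>z. E z ^ n = G z - \<omega> k)" for k
    proof -
      \<comment> \<open>The cofactor of \<open>G - \<omega>\<close> in \<open>1 - G ^ m\<close>; at \<open>G = \<omega>\<close> it is \<open>- m * \<omega> ^ (m - 1)\<close>, since the root \<open>\<omega>\<close> is simple.\<close>
      define R where "R = (\<lambda>z. - (\<Sum>i<m. G z ^ i * \<omega> k ^ (m - Suc i)))"
      have e: "(G z - \<omega> k) * R z = F z ^ n" for z
      proof -
        have "(G z - \<omega> k) * R z = - (G z ^ m - \<omega> k ^ m)"
          unfolding R_def power_diff_sumr2[of "G z" m "\<omega> k"] by (simp add: mult.commute)
        also have "\<dots> = F z ^ n" using eq[of z] om by (simp add: algebra_simps)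
        finally show ?thesis .
      qed
      have nz: "R z \<noteq> 0" if "G z - \<omega> k = 0" for z
      proof -
        have "R z = - (\<Sum>i<m. \<omega> k ^ (m - 1))"
          unfolding R_def using that by (auto simp flip: power_add intro!: sum.cong)
        then show ?thesis using m by (simp add: \<omega>_def)
      qed
      have h: "R holomorphic_on UNIV" "(\<lambda>z. G z - \<omega> k) holomorphic_on UNIV"
        unfolding R_def by (intro holomorphic_intros hol)+
      obtain E where "E holomorphic_on UNIV" "\<And>z. E z ^ n = G z - \<omega> k"
        by (rule entire_coprime_factor_nth_root[OF h(2,1) hol(1) _ e nz w]) (use n in auto)
      then show ?thesis by blast
    qed
    obtain a b d where ab: "a holomorphic_on UNIV" "\<And>z. a z ^ n = G z - \<omega> 0"
        "b holomorphic_on UNIV" "\<And>z. b z ^ n = G z - \<omega> 1"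
        "d holomorphic_on UNIV" "\<And>z. d z ^ n = G z - \<omega> 2"
      using root[of 0] root[of 1] root[of 2] by metis
    show ?thesis
    proof (cases "n = 2")
      case True
      have "a constant_on UNIV"
        by (rule entire_three_squares_constant[OF ab(1,3,5), of "\<omega> 1 - \<omega> 0" "\<omega> 2 - \<omega> 0"])
           (use ab True ne in auto)
      then obtain k where "\<And>z. a z = k" by (auto simp: constant_on_def)
      then have "G z = k ^ n + \<omega> 0" for z using ab(2)[of z] by (simp add: algebra_simps)
      then show ?thesis by (auto simp: constant_on_def)
    next
      case False
      then have "n \<ge> 3" using n by simp
      then have "b constant_on UNIV"
        by (rule entire_power_diff_constant[OF ab(1,3), where K = "\<omega> 1 - \<omega> 0"]) (use ab ne in auto)
      then obtain k where "\<And>z. b z = k" by (auto simp: constant_on_def)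
      then have "G z = k ^ n + \<omega> 1" for z using ab(4)[of z] by (simp add: algebra_simps)
      then show ?thesis by (auto simp: constant_on_def)
    qed
  qed
  moreover from this obtain k where "\<And>z. G z = k" by (auto simp: constant_on_def)
  then have "F z ^ n = 1 - k ^ m" for z using eq[of z] by (simp add: algebra_simps)
  then have "F constant_on UNIV" using entire_power_constant[OF contF, of n] n by auto
  ultimately show ?thesis by blast
qed

section \<open>Ahlfors' lemma for a triple of entire functions\<close>

text \<open>
This splits \<open>N z * N z0\<close> into the squared modulus of a function holomorphic in \<open>z\<close> and a remainder
which vanishes to second order at \<open>z0\<close>. The remainder is what the Laplacian of \<open>ln N\<close> sees.
\<close>
lemma lagrange_identity_complex3:
  fixes a b q a0 b0 q0 :: complex
  shows "((norm a)^2 + (norm b)^2 + (norm q)^2) * ((norm a0)^2 + (norm b0)^2 + (norm q0)^2)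
     = (norm (a * cnj a0 + b * cnj b0 + q * cnj q0))^2
       + ((norm (a * b0 - a0 * b))^2 + (norm (a * q0 - a0 * q))^2 + (norm (b * q0 - b0 * q))^2)"
  unfolding cmod_power2 by (simp add: algebra_simps power2_eq_square)

text \<open>
The corresponding splitting of \<open>R^2 - |z|^2\<close>, from which the hyperbolic density of the disc is built:
a squared modulus of a function holomorphic in \<open>\<zeta>\<close>, minus a term of second order.
\<close>
lemma disc_gap_shift:
  fixes z0 \<zeta> :: complex
  assumes "D = R^2 - (norm z0)^2" "D \<noteq> 0"
  shows "R^2 - (norm (z0 + \<zeta>))^2
       = D * ((norm (1 - cnj z0 * \<zeta> / of_real D))^2 - R^2 * (norm \<zeta>)^2 / D^2)"
proof -
  define x y u v where "x = Re z0" "y = Im z0" "u = Re \<zeta>" "v = Im \<zeta>"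
  have R: "R^2 = D + x^2 + y^2" using assms by (simp add: cmod_power2 x_y_u_v_def)
  have e: "(norm (1 - cnj z0 * \<zeta> / of_real D))^2 = (1 - (x * u + y * v)/D)^2 + ((x * v - y * u)/D)^2"
    by (simp add: cmod_power2 x_y_u_v_def Re_divide_of_real Im_divide_of_real algebra_simps)
  have "(norm (z0+\<zeta>))^2 = (x+u)^2+(y+v)^2" "(norm \<zeta>)^2 = u^2+v^2"
    by (simp_all add: cmod_power2 x_y_u_v_def)
  then show ?thesis unfolding e R using assms(2)
    by (simp add: power2_eq_square field_simps)
qed

text \<open>
The assumption \<open>curv\<close> bounds the curvature of the density \<open>|\<psi>|^2 * N ^ s\<close> above by a negative constant. On the disc of
radius \<open>R\<close>, let \<open>v\<close> be, up to a constant, the quotient of this density by the hyperbolic one; it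
vanishes on the boundary circle and has a maximum at some \<open>z0\<close>. There the second-order terms are controlled by
\<open>2 * R^2 / D^2\<close>, where \<open>D = R^2 - |z0|^2\<close>, which yields \<open>K * v z0 \<le> 2 * R^2\<close>, and letting \<open>R\<close> tend to infinity gives
\<open>\<psi> 0 = 0\<close>.

The usual second-derivative test for \<open>ln v\<close> is replaced by the maximum modulus principle: by the two
splittings above, \<open>v (z0 + \<zeta>)\<close> is, up to a constant, the squared modulus of a holomorphic function \<open>Y\<close> times
a factor \<open>(1 + S) ^ s * (1 - T)^2\<close> whose deviation from \<open>1\<close> is of second order in \<open>\<zeta>\<close>. Were this factor
larger than \<open>1\<close> for all small \<open>\<zeta> \<noteq> 0\<close>, then \<open>|Y|\<close> would have a strict local maximum.
\<close>
lemma ahlfors_schwarz_at_0: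
  fixes \<psi> a b q :: "complex \<Rightarrow> complex"
  defines "N \<equiv> \<lambda>z. (norm (a z))^2 + (norm (b z))^2 + (norm (q z))^2"
  assumes hol: "\<psi> holomorphic_on UNIV" "a holomorphic_on UNIV" "b holomorphic_on UNIV"
      "q holomorphic_on UNIV"
    and N_pos: "\<And>z. N z > 0" and s: "s \<ge> 1" and K: "K > 0"
    and curv: "\<And>z. K * (norm (\<psi> z))^2 * N z ^ (s + 2) \<le>
        (norm (deriv a z * b z - a z * deriv b z))^2
      + (norm (deriv a z * q z - a z * deriv q z))^2
      + (norm (deriv b z * q z - b z * deriv q z))^2"
  shows "\<psi> 0 = 0"
proof -
  have cont: "continuous_on A \<psi>" "continuous_on A a" "continuous_on A b" "continuous_on A q" for A
    using hol holomorphic_on_imp_continuous_on continuous_on_subset by blast+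
  have main: "(norm (\<psi> 0))^2 * N 0 ^ s * (K * R^2) \<le> 2" if R: "R > 0" for R
  proof -
    define v where "v = (\<lambda>z. (norm (\<psi> z))^2 * N z ^ s * (R^2 - (norm z)^2)^2)"
    have "continuous_on (cball 0 R) v"
      unfolding v_def N_def by (intro continuous_intros cont)
    then obtain z0 where z0: "z0 \<in> cball 0 R" and vmax: "\<And>z. z \<in> cball 0 R \<Longrightarrow> v z \<le> v z0"
      using continuous_attains_sup[of "cball 0 R" v] R by (metis compact_cball cball_eq_empty not_less_iff_gr_or_eq)
    have v0: "v 0 = (norm (\<psi> 0))^2 * N 0 ^ s * R^4"
      by (simp add: v_def)
    show ?thesis
    proof (cases "v z0 = 0")
      case True
      then have "v 0 \<le> 0" using vmax[of 0] R by simp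
      moreover have "N 0 ^ s > 0" using N_pos by simp
      ultimately have "\<psi> 0 = 0" unfolding v0 using R
        by (metis mult_pos_pos norm_eq_zero not_less zero_less_power zero_less_power2)
      then show ?thesis by simp
    next
      case False
      define D where "D = R^2 - (norm z0)^2"
      have Dnz: "D \<noteq> 0" and \<psi>nz: "\<psi> z0 \<noteq> 0" using False by (auto simp: v_def D_def)
      moreover have "D \<ge> 0" using z0 R by (simp add: D_def power_mono)
      ultimately have D: "D > 0" by simp
      have z0in: "norm z0 < R" using D R unfolding D_def
        by (metis diff_gt_0_iff_gt less_imp_le power2_less_imp_less)
      define N0 where "N0 = N z0"
      have N0: "N0 > 0" using N_pos N0_def by simp
      define W where "W = (norm (deriv a z0 * b z0 - a z0 * deriv b z0))^2
      + (norm (deriv a z0 * q z0 - a z0 * deriv q z0))^2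
      + (norm (deriv b z0 * q z0 - b z0 * deriv q z0))^2"
      \<comment> \<open>Conjugating only the values at the fixed point \<open>z0\<close> keeps \<open>P\<close>, and with it \<open>Y\<close>, holomorphic in \<open>\<zeta>\<close>.\<close>
      define P where "P = (\<lambda>\<zeta>. a (z0+\<zeta>) * cnj (a z0) + b (z0+\<zeta>) * cnj (b z0) + q (z0+\<zeta>) * cnj (q z0))"
      \<comment> \<open>Up to a term of second order in \<open>\<zeta>\<close>, \<open>R^2 - |z0 + \<zeta>|^2\<close> is \<open>D\<close> times the squared modulus of \<open>E\<close>.\<close>
      define E where "E = (\<lambda>\<zeta>. 1 - cnj z0 * \<zeta> / of_real D)"
      define Y where "Y = (\<lambda>\<zeta>. \<psi> (z0+\<zeta>) * P \<zeta> ^ s * E \<zeta> ^ 2)"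
      define M where "M = (\<lambda>\<zeta>. (norm (a (z0+\<zeta>) * b z0 - a z0 * b (z0+\<zeta>)))^2
         + (norm (a (z0+\<zeta>) * q z0 - a z0 * q (z0+\<zeta>)))^2 + (norm (b (z0+\<zeta>) * q z0 - b z0 * q (z0+\<zeta>)))^2)"
      define \<sigma> where "\<sigma> = (\<lambda>\<zeta>. M \<zeta> / (norm \<zeta>)^2 / (norm (P \<zeta>))^2)"
      define \<tau> where "\<tau> = (\<lambda>\<zeta>. R^2 / (D^2 * (norm (E \<zeta>))^2))"
      have P0: "P 0 = of_real N0"
        unfolding P_def N0_def N_def by (simp add: complex_norm_square[symmetric])
      have E0: "E 0 = 1" by (simp add: E_def)
      have holt: "(\<lambda>\<zeta>. f (z0+\<zeta>)) holomorphic_on UNIV" if "f holomorphic_on UNIV" for f :: "complex \<Rightarrow> complex"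
        using holomorphic_on_translate[OF that, of z0] by (simp add: add.commute)
      have Phol: "P holomorphic_on UNIV" unfolding P_def
        by (intro holomorphic_intros holt hol)
      have Ehol: "E holomorphic_on UNIV" unfolding E_def by (intro holomorphic_intros) (use Dnz in auto)
      have Yhol: "Y holomorphic_on UNIV" unfolding Y_def
        by (intro holomorphic_intros holt hol Phol Ehol)
      have tend: "(f \<longlongrightarrow> f 0) (at 0)" if "f holomorphic_on UNIV" for f :: "complex \<Rightarrow> complex"
        using that by (metis UNIV_I continuous_on_eq_continuous_at holomorphic_on_imp_continuous_on isContD open_UNIV)
      have Plim: "(P \<longlongrightarrow> of_real N0) (at 0)" using tend[OF Phol] P0 by simp
      have Elim: "(E \<longlongrightarrow> 1) (at 0)" using tend[OF Ehol] E0 by simp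
      have wlim: "((\<lambda>\<zeta>. (norm (f (z0+\<zeta>) * g z0 - f z0 * g (z0+\<zeta>)))^2 / (norm \<zeta>)^2)
           \<longlongrightarrow> (norm (deriv f z0 * g z0 - f z0 * deriv g z0))^2) (at 0)"
        if "f holomorphic_on UNIV" "g holomorphic_on UNIV" for f g
      proof -
        have df: "(f has_field_derivative deriv f z0) (at z0)" "(g has_field_derivative deriv g z0) (at z0)"
          using that holomorphic_derivI by blast+
        have "((\<lambda>z. f z * g z0 - f z0 * g z) has_field_derivative (deriv f z0 * g z0 - f z0 * deriv g z0)) (at z0)"
          by (auto intro!: derivative_eq_intros df)
        then have "((\<lambda>\<zeta>. (f (z0+\<zeta>) * g z0 - f z0 * g (z0+\<zeta>)) / \<zeta>) \<longlongrightarrow> deriv f z0 * g z0 - f z0 * deriv g z0) (at 0)"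
          by (simp add: DERIV_def)
        then have "((\<lambda>\<zeta>. (norm ((f (z0+\<zeta>) * g z0 - f z0 * g (z0+\<zeta>)) / \<zeta>))^2) \<longlongrightarrow> (norm (deriv f z0 * g z0 - f z0 * deriv g z0))^2) (at 0)"
          by (intro tendsto_intros)
        then show ?thesis by (simp add: norm_divide power_divide)
      qed
      have Mlim: "((\<lambda>\<zeta>. M \<zeta> / (norm \<zeta>)^2) \<longlongrightarrow> W) (at 0)"
        unfolding M_def W_def add_divide_distrib by (intro tendsto_add wlim hol)
      have \<sigma>lim: "(\<sigma> \<longlongrightarrow> W / (norm (complex_of_real N0))^2) (at 0)"
        unfolding \<sigma>_def by (intro tendsto_divide Mlim tendsto_power tendsto_norm Plim) (use N0 in auto)
      then have \<sigma>lim: "(\<sigma> \<longlongrightarrow> W / N0^2) (at 0)" by simp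
      have \<tau>lim: "(\<tau> \<longlongrightarrow> R^2 / (D^2 * (norm (1::complex))^2)) (at 0)"
        unfolding \<tau>_def by (intro tendsto_intros Elim) (use D in auto)
      then have \<tau>lim: "(\<tau> \<longlongrightarrow> R^2 / D^2) (at 0)" by simp
      \<comment> \<open>In terms of \<open>ln v\<close>: its Laplacian at a maximum is not positive, with the factor \<open>s\<close> of the Laplacian of \<open>ln N\<close> lowered to \<open>1\<close>.\<close>
      have local: "W / N0^2 \<le> 2 * (R^2 / D^2)"
      proof (rule ccontr)
        assume "\<not> ?thesis"
        then have gt: "W / N0^2 > 2 * (R^2 / D^2)" by simp
        have lim2: "((\<lambda>\<zeta>. \<sigma> \<zeta> - 2 * \<tau> \<zeta> * (1 + (norm \<zeta>)^2 * \<sigma> \<zeta>)) \<longlongrightarrow>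
              W/N0^2 - 2 * (R^2/D^2) * (1 + (norm (0::complex))^2 * (W/N0^2))) (at 0)"
          by (intro tendsto_intros \<sigma>lim \<tau>lim)
        have ev1: "eventually (\<lambda>\<zeta>. \<sigma> \<zeta> - 2 * \<tau> \<zeta> * (1 + (norm \<zeta>)^2 * \<sigma> \<zeta>) > 0) (at 0)"
          using order_tendstoD(1)[OF lim2, of 0] gt by simp
        have ev2: "eventually (\<lambda>\<zeta>. P \<zeta> \<noteq> 0) (at 0)"
          using tendsto_imp_eventually_ne[OF Plim, of 0] N0 by simp
        have ev3: "eventually (\<lambda>\<zeta>. E \<zeta> \<noteq> 0) (at 0)"
          using tendsto_imp_eventually_ne[OF Elim, of 0] by simp
        have ev4: "eventually (\<lambda>\<zeta>. z0 + \<zeta> \<in> ball 0 R) (at 0)"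
        proof -
          have "((\<lambda>\<zeta>. z0 + \<zeta>) \<longlongrightarrow> z0 + 0) (at 0)" by (intro tendsto_intros)
          then show ?thesis using topological_tendstoD[of _ "z0+0" "at 0" "ball 0 R"] z0in by simp
        qed
        have "eventually (\<lambda>\<zeta>. norm (Y \<zeta>) < norm (Y 0)) (at 0)"
          using ev1 ev2 ev3 ev4 eventually_neq_at_within[of 0 0 UNIV]
        proof eventually_elim
          case (elim \<zeta>)
          define S where "S = (norm \<zeta>)^2 * \<sigma> \<zeta>"
          define T where "T = (norm \<zeta>)^2 * \<tau> \<zeta>"
          have pos: "(norm \<zeta>)^2 > 0" "(norm (P \<zeta>))^2 > 0" "(norm (E \<zeta>))^2 > 0" using elim by auto
          have M0: "M \<zeta> \<ge> 0" unfolding M_def by simp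
          then have S0: "S \<ge> 0" unfolding S_def \<sigma>_def by simp
          have "(norm \<zeta>)^2 * (\<sigma> \<zeta> - 2 * \<tau> \<zeta> * (1 + (norm \<zeta>)^2 * \<sigma> \<zeta>)) > 0"
            using pos elim by simp
          then have ST: "S - 2 * T * (1 + S) > 0" unfolding S_def T_def by (simp add: algebra_simps)
          have "(1 + S) * (1 - T)^2 = 1 + (S - 2 * T * (1 + S)) + (1+S) * T^2"
            by (simp add: power2_eq_square algebra_simps)
          moreover have "(1+S) * T^2 \<ge> 0" using S0 by simp
          ultimately have g1: "(1 + S) * (1 - T)^2 > 1" using ST by linarith
          have "(1+S) \<le> (1+S)^s" using S0 s by (metis le_add_same_cancel1 power_increasing power_one_right)
          then have g2: "(1+S)^s * (1-T)^2 > 1" using g1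
            by (smt (verit) mult_right_mono zero_le_power2)
          have NP: "N (z0+\<zeta>) * N0 = (norm (P \<zeta>))^2 * (1 + S)"
          proof -
            have "N (z0+\<zeta>) * N0 = (norm (P \<zeta>))^2 + M \<zeta>"
              unfolding N_def N0_def lagrange_identity_complex3 by (simp add: P_def M_def)
            moreover have "S = M \<zeta> / (norm (P \<zeta>))^2" unfolding S_def \<sigma>_def using pos by simp
            ultimately show ?thesis using pos by (simp add: distrib_left)
          qed
          have Dg: "R^2 - (norm (z0+\<zeta>))^2 = D * ((norm (E \<zeta>))^2 * (1 - T))"
          proof -
            have "R^2 - (norm (z0+\<zeta>))^2 = D * ((norm (E \<zeta>))^2 - R^2 * (norm \<zeta>)^2 / D^2)"
              using disc_gap_shift[OF D_def Dnz, of \<zeta>] by (simp add: E_def)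
            also have "R^2 * (norm \<zeta>)^2 / D^2 = (norm (E \<zeta>))^2 * T"
              unfolding T_def \<tau>_def using pos D by (simp add: field_simps)
            finally show ?thesis by (simp add: right_diff_distrib)
          qed
          have "v (z0+\<zeta>) * N0^s \<le> v z0 * N0^s"
            using vmax[of "z0+\<zeta>"] elim N0 by (intro mult_right_mono) auto
          also have "v z0 * N0^s = (norm (Y 0))^2 * D^2"
            unfolding v_def Y_def P0 E0 D_def[symmetric] N0_def[symmetric] using N0
            by (simp add: norm_mult norm_power power_mult_distrib power2_eq_square)
          also have "v (z0+\<zeta>) * N0^s = (norm (\<psi> (z0+\<zeta>)))^2 * (N (z0+\<zeta>) * N0)^s * (R^2 - (norm (z0+\<zeta>))^2)^2"
            by (simp add: v_def power_mult_distrib)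
          also have "\<dots> = ((norm (Y \<zeta>))^2 * D^2) * ((1+S)^s * (1-T)^2)"
            unfolding NP Dg Y_def
            by (simp add: norm_mult norm_power power_mult_distrib mult_ac flip: power_mult)
          finally have le: "(norm (Y \<zeta>))^2 * ((1+S)^s * (1-T)^2) \<le> (norm (Y 0))^2"
            using D by (simp add: field_simps)
          have Y0: "Y 0 \<noteq> 0" unfolding Y_def P0 E0 using \<psi>nz N0 by simp
          show ?case
          proof (cases "Y \<zeta> = 0")
            case True then show ?thesis using Y0 by simp
          next
            case False
            then have "(norm (Y \<zeta>))^2 * 1 < (norm (Y \<zeta>))^2 * ((1+S)^s * (1-T)^2)"
              using g2 by (intro mult_strict_left_mono) auto
            then show ?thesis using le by (metis mult.right_neutral norm_ge_zero order_less_le_trans power2_less_imp_less)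
          qed
        qed
        then obtain d where d: "d > 0" "\<And>\<zeta>. \<zeta> \<noteq> 0 \<Longrightarrow> norm \<zeta> < d \<Longrightarrow> norm (Y \<zeta>) < norm (Y 0)"
          unfolding eventually_at by (auto simp: dist_norm)
        have "Y constant_on (ball 0 d)"
        proof (rule maximum_modulus_principle[of Y "ball 0 d" "ball 0 d" 0])
          show "Y holomorphic_on ball 0 d" using Yhol holomorphic_on_subset by blast
          show "norm (Y z) \<le> norm (Y 0)" if "z \<in> ball 0 d" for z
            using d(2)[of z] that by (cases "z = 0") auto
        qed (use d in auto)
        then have "Y (of_real (d/2)) = Y 0" using d(1) unfolding constant_on_def by auto
        moreover have "norm (Y (of_real (d/2))) < norm (Y 0)" using d by (intro d(2)) auto
        ultimately show False by simp
      qed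
      have "K * (norm (\<psi> z0))^2 * N0^s * N0^2 \<le> W"
        using curv[of z0] unfolding W_def N0_def by (simp add: power2_eq_square algebra_simps)
      then have "K * (norm (\<psi> z0))^2 * N0^s \<le> W / N0^2" using N0 by (simp add: field_simps)
      also note local
      finally have "K * v z0 \<le> 2 * R^2"
        using D unfolding v_def D_def[symmetric] N0_def[symmetric] by (simp add: field_simps)
      moreover have "K * v 0 \<le> K * v z0" using vmax[of 0] R K by simp
      ultimately have "K * ((norm (\<psi> 0))^2 * N 0 ^ s * R^4) \<le> 2 * R^2" unfolding v0 by linarith
      then have "R^2 * ((norm (\<psi> 0))^2 * N 0 ^ s * (K * R^2)) \<le> R^2 * 2"
        by (simp add: algebra_simps power4_eq_xxxx power2_eq_square)
      then show ?thesis using R by simp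
    qed
  qed
  show ?thesis
  proof (rule ccontr)
    assume "\<psi> 0 \<noteq> 0"
    define C where "C = (norm (\<psi> 0))^2 * N 0 ^ s * K"
    have C: "C > 0" unfolding C_def using N_pos[of 0] K \<open>\<psi> 0 \<noteq> 0\<close> by simp
    define R where "R = sqrt (3 / C)"
    have "R > 0" "R^2 = 3 / C" using C unfolding R_def by simp_all
    moreover have "C * R^2 \<le> 2" using main[of R] \<open>R > 0\<close> by (simp add: C_def mult_ac)
    ultimately show False using C by simp
  qed
qed

lemma ahlfors_schwarz:
  fixes \<psi> a b q :: "complex \<Rightarrow> complex"
  defines "N \<equiv> \<lambda>z. (norm (a z))^2 + (norm (b z))^2 + (norm (q z))^2"
  assumes hol: "\<psi> holomorphic_on UNIV" "a holomorphic_on UNIV" "b holomorphic_on UNIV"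
      "q holomorphic_on UNIV"
    and N_pos: "\<And>z. N z > 0" and s: "s \<ge> 1" and K: "K > 0"
    and curv: "\<And>z. K * (norm (\<psi> z))^2 * N z ^ (s + 2) \<le>
        (norm (deriv a z * b z - a z * deriv b z))^2
      + (norm (deriv a z * q z - a z * deriv q z))^2
      + (norm (deriv b z * q z - b z * deriv q z))^2"
  shows "\<psi> w = 0"
proof -
  note holt = holomorphic_on_translate[where c = w]
  have dt: "deriv (\<lambda>\<zeta>. f (\<zeta>+w)) z = deriv f (z+w)" if "f holomorphic_on UNIV" for f :: "complex \<Rightarrow> complex" and z
    by (intro DERIV_imp_deriv) (use that in \<open>simp add: DERIV_shift[symmetric] holomorphic_derivI\<close>)
  have "(\<lambda>\<zeta>. \<psi> (\<zeta> + w)) 0 = 0"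
    by (rule ahlfors_schwarz_at_0[of _ "\<lambda>\<zeta>. a (\<zeta>+w)" "\<lambda>\<zeta>. b (\<zeta>+w)" "\<lambda>\<zeta>. q (\<zeta>+w)" s K])
       (use N_pos s K curv in \<open>simp_all add: holt hol dt N_def\<close>)
  then show ?thesis by simp
qed

section \<open>Meromorphic solutions of the Fermat equation of degree at least four\<close>

text \<open>
The derivative of \<open>a / q\<close> is the Wronskian divided by \<open>q^2\<close>, so \<open>a / q\<close> is constant near \<open>w\<close>; the
identity theorem extends the proportionality to the whole plane.
\<close>
lemma wronskian_zero_imp_proportional:
  fixes a q :: "complex \<Rightarrow> complex"
  assumes hol: "a holomorphic_on UNIV" "q holomorphic_on UNIV"
    and W: "\<And>z. deriv a z * q z = a z * deriv q z" and qw: "q w \<noteq> 0"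
  shows "a z = a w / q w * q z"
proof -
  have "isCont q w" using hol(2) by (metis UNIV_I continuous_on_eq_continuous_at holomorphic_on_imp_continuous_on open_UNIV)
  then obtain e where e: "e > 0" "\<And>z. z \<in> ball w e \<Longrightarrow> q z \<noteq> 0"
    using continuous_at_avoid[of w q 0] qw by (auto simp: dist_commute)
  have "((\<lambda>z. a z / q z) has_field_derivative 0) (at z within ball w e)" if "z \<in> ball w e" for z
  proof -
    have "((\<lambda>z. a z / q z) has_field_derivative (deriv a z * q z - a z * deriv q z) / (q z * q z)) (at z)"
      by (intro DERIV_divide holomorphic_derivI[of _ UNIV] hol) (use e that in auto)
    then show ?thesis using W has_field_derivative_at_within by fastforce
  qed
  then obtain k where k: "\<And>z. z \<in> ball w e \<Longrightarrow> a z / q z = k"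
    using has_field_derivative_zero_constant[of "ball w e" "\<lambda>z. a z / q z"] by auto
  have kw: "k = a w / q w" using k[of w] e by simp
  have "a z - k * q z = 0"
  proof (rule analytic_continuation_open[of "ball w e" UNIV "\<lambda>z. a z - k * q z" "\<lambda>_. 0"])
    show "a z - k * q z = 0" if "z \<in> ball w e" for z
      using k[OF that] e(2)[OF that] by (auto simp: field_simps)
  qed (use e in \<open>auto intro!: holomorphic_intros hol connected_UNIV\<close>)
  then show ?thesis using kw by simp
qed

text \<open>
Eliminating between the equation and its derivative shows that each Wronskian is proportional to the
\<open>(n-1)\<close>-st power of the function that does not occur in it. The common factor \<open>\<psi>\<close> is the pullback
of a holomorphic differential of the Fermat curve, hence entire. As \<open>N ^ (n-1)\<close> is at most a constant
times \<open>|a| ^ (2(n-1)) + |b| ^ (2(n-1)) + |q| ^ (2(n-1))\<close>, the curvature hypothesis of Ahlfors' lemma holds with \<open>s = n - 3\<close>,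
which is positive exactly when \<open>n \<ge> 4\<close>.
\<close>
lemma fermat_triple_wronskian_zero:
  fixes a b q :: "complex \<Rightarrow> complex"
  assumes hol: "a holomorphic_on UNIV" "b holomorphic_on UNIV" "q holomorphic_on UNIV"
    and n: "n \<ge> 4" and eq: "\<And>z. a z ^ n + b z ^ n = q z ^ n"
    and nc: "\<And>z. \<not> (a z = 0 \<and> b z = 0)"
  shows "deriv a z * q z = a z * deriv q z" "deriv b z * q z = b z * deriv q z"
proof -
  obtain k where k: "n = Suc k" "k \<ge> 3" using n by (cases n) auto
  have k2: "k - 2 + 2 = k" using k by simp
  have k0: "(0::complex) ^ k = 0" using k by simp
  define Waq where "Waq = (\<lambda>z. deriv a z * q z - a z * deriv q z)"
  define Wbq where "Wbq = (\<lambda>z. deriv b z * q z - b z * deriv q z)"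
  define Wab where "Wab = (\<lambda>z. deriv a z * b z - a z * deriv b z)"
  have Whol: "Waq holomorphic_on UNIV" "Wbq holomorphic_on UNIV"
    unfolding Waq_def Wbq_def by (intro holomorphic_intros hol; simp)+
  have deq: "a z ^ k * deriv a z + b z ^ k * deriv b z = q z ^ k * deriv q z" for z
  proof -
    have "((\<lambda>z. a z ^ n + b z ^ n) has_field_derivative
        of_nat n * (deriv a z * a z ^ (n - Suc 0)) + of_nat n * (deriv b z * b z ^ (n - Suc 0))) (at z)"
      by (intro DERIV_add DERIV_power holomorphic_derivI[of _ UNIV] hol) auto
    moreover have "((\<lambda>z. q z ^ n) has_field_derivative of_nat n * (deriv q z * q z ^ (n - Suc 0))) (at z)"
      by (intro DERIV_power holomorphic_derivI[of _ UNIV] hol) auto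
    ultimately have "of_nat n * (deriv a z * a z ^ k) + of_nat n * (deriv b z * b z ^ k) = of_nat n * (deriv q z * q z ^ k)"
      unfolding eq using k DERIV_unique by force
    then have "of_nat n * (a z ^ k * deriv a z + b z ^ k * deriv b z) = of_nat n * (q z ^ k * deriv q z)"
      by (simp only: distrib_left mult.commute mult.left_commute)
    then show ?thesis using n by (metis mult_left_cancel not_numeral_le_zero of_nat_eq_0_iff)
  qed
  have r1: "a z ^ k * Waq z = - (b z ^ k * Wbq z)" for z
  proof -
    have "a z ^ k * Waq z + b z ^ k * Wbq z
       = (a z ^ k * deriv a z + b z ^ k * deriv b z) * q z - (a z ^ n + b z ^ n) * deriv q z"
      unfolding Waq_def Wbq_def k by (simp add: algebra_simps)
    also have "\<dots> = 0" unfolding deq eq by (simp add: k)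
    finally show ?thesis by (simp add: add_eq_0_iff2)
  qed
  have r2: "a z ^ k * Wab z = - (q z ^ k * Wbq z)" for z
  proof -
    have "a z ^ k * Wab z + q z ^ k * Wbq z
       = (a z ^ k * deriv a z + b z ^ k * deriv b z - q z ^ k * deriv q z) * b z 
         - deriv b z * (a z ^ n + b z ^ n - q z ^ n)"
      unfolding Wab_def Wbq_def k by (simp add: algebra_simps)
    also have "\<dots> = 0" unfolding deq eq by simp
    finally show ?thesis by (simp add: add_eq_0_iff2)
  qed
  have r3: "b z ^ k * Wab z = q z ^ k * Waq z" for z
  proof -
    have "b z ^ k * Wab z - q z ^ k * Waq z
       = - (a z ^ k * deriv a z + b z ^ k * deriv b z - q z ^ k * deriv q z) * a z 
         + deriv a z * (a z ^ n + b z ^ n - q z ^ n)"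
      unfolding Wab_def Waq_def k by (simp add: algebra_simps)
    also have "\<dots> = 0" unfolding deq eq by simp
    finally show ?thesis by simp
  qed
  \<comment> \<open>Two expressions for the same function, one for the complement of the zeros of each of \<open>b\<close> and \<open>a\<close>.\<close>
  define \<psi> where "\<psi> = (\<lambda>z. if b z = 0 then - Wbq z / a z ^ k else Waq z / b z ^ k)"
  have \<psi>2: "\<psi> z = - Wbq z / a z ^ k" if "a z \<noteq> 0" for z
    using that r1[of z] unfolding \<psi>_def by (simp add: field_simps)
  have \<psi>aq: "Waq z = \<psi> z * b z ^ k" for z
    using r1[of z] nc[of z] by (auto simp: \<psi>_def k0)
  have \<psi>bq: "Wbq z = - \<psi> z * a z ^ k" for z
    using r1[of z] nc[of z] by (cases "a z = 0") (auto simp: \<psi>2 k0)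
  have \<psi>ab: "Wab z = \<psi> z * q z ^ k" for z
    using r2[of z] r3[of z] nc[of z] unfolding \<psi>aq \<psi>bq by (cases "a z = 0") (auto simp: k0)
  have opn: "open {z. f z \<noteq> 0}" if "f holomorphic_on UNIV" for f :: "complex \<Rightarrow> complex"
    using that by (intro open_Collect_neq holomorphic_on_imp_continuous_on) auto
  have "\<psi> holomorphic_on ({z. b z \<noteq> 0} \<union> {z. a z \<noteq> 0})"
  proof (rule holomorphic_on_Un)
    have "(\<lambda>z. Waq z / b z ^ k) holomorphic_on {z. b z \<noteq> 0}"
      by (intro holomorphic_intros holomorphic_on_subset[OF Whol(1)] holomorphic_on_subset[OF hol(2)]) auto
    then show "\<psi> holomorphic_on {z. b z \<noteq> 0}" by (rule holomorphic_transform) (simp add: \<psi>_def)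
    have "(\<lambda>z. - Wbq z / a z ^ k) holomorphic_on {z. a z \<noteq> 0}"
      by (intro holomorphic_intros holomorphic_on_subset[OF Whol(2)] holomorphic_on_subset[OF hol(1)]) auto
    then show "\<psi> holomorphic_on {z. a z \<noteq> 0}" by (rule holomorphic_transform) (simp add: \<psi>2)
  qed (intro opn hol)+
  also have "{z. b z \<noteq> 0} \<union> {z. a z \<noteq> 0} = UNIV" using nc by auto
  finally have \<psi>hol: "\<psi> holomorphic_on UNIV" .
  have "\<psi> z = 0" for z
  proof (rule ahlfors_schwarz[OF \<psi>hol hol, where s = "k - 2" and K = "1 / 3 ^ k"])
    fix z
    show "0 < (norm (a z))^2 + (norm (b z))^2 + (norm (q z))^2"
      using nc[of z] by (cases "a z = 0") (auto simp: add_pos_nonneg add_nonneg_pos)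
    let ?x = "(norm (a z))^2" and ?y = "(norm (b z))^2" and ?w = "(norm (q z))^2"
    have pow: "(?x + ?y + ?w) ^ k \<le> 3 ^ k * (?x ^ k + ?y ^ k + ?w ^ k)"
    proof -
      define m where "m = max ?x (max ?y ?w)"
      have "m \<ge> 0" unfolding m_def by (simp add: le_max_iff_disj)
      have "(?x + ?y + ?w) ^ k \<le> (3 * m) ^ k" by (intro power_mono) (auto simp: m_def)
      also have "\<dots> = 3 ^ k * m ^ k" by (simp add: power_mult_distrib)
      also have "m ^ k \<le> ?x ^ k + ?y ^ k + ?w ^ k"
        unfolding m_def max_def by auto
      finally show ?thesis by simp
    qed
    have "1 / 3 ^ k * (norm (\<psi> z))^2 * (?x + ?y + ?w) ^ k \<le> (norm (\<psi> z))^2 * (?x ^ k + ?y ^ k + ?w ^ k)"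
      using mult_left_mono[OF pow, of "(norm (\<psi> z))^2"] by (simp add: field_simps)
    also have "\<dots> = (norm (Wab z))^2 + (norm (Waq z))^2 + (norm (Wbq z))^2"
      unfolding \<psi>ab \<psi>aq \<psi>bq
      by (simp add: norm_mult norm_power power_mult_distrib algebra_simps flip: power_mult)
    finally show "1 / 3 ^ k * (norm (\<psi> z))^2 * (?x + ?y + ?w) ^ (k - 2 + 2)
      \<le> (norm (deriv a z * b z - a z * deriv b z))^2
      + (norm (deriv a z * q z - a z * deriv q z))^2
      + (norm (deriv b z * q z - b z * deriv q z))^2"
      using k2 by (simp only: Wab_def Waq_def Wbq_def)
  qed (use k in auto)
  then have "Waq z = 0" "Wbq z = 0" unfolding \<psi>aq \<psi>bq by auto
  then show "deriv a z * q z = a z * deriv q z" "deriv b z * q z = b z * deriv q z"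
    unfolding Waq_def Wbq_def by auto
qed

section \<open>The reduction to constants\<close>

text \<open>
Infinite descent on the order of a zero: if \<open>n < m\<close> the zero at \<open>z + c\<close> has a smaller order than the one at
\<open>z\<close>, and if \<open>n > m\<close> the same is true of the zero at \<open>z - c\<close>.
\<close>
lemma no_zeros_if_orders_scale:
  fixes q :: "complex \<Rightarrow> complex"
  assumes hol: "q holomorphic_on UNIV" and w: "q w \<noteq> 0" and nm: "n > 0" "m > 0" "n \<noteq> m"
    and iff: "\<And>z. q (z + c) = 0 \<longleftrightarrow> q z = 0"
    and ord: "\<And>z. q z = 0 \<Longrightarrow> int n * zorder q z = int m * zorder q (z + c)"
  shows "q z \<noteq> 0"
proof
  assume z: "q z = 0"
  have pos: "zorder q z > 0" if "q z = 0" for z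
    using that entire_eventually_nonzero[OF hol w, of z]
    by (subst zorder_pos_iff') (auto intro: entire_analytic_at[OF hol] eventually_frequently)
  have smaller: "\<exists>z'. q z' = 0 \<and> zorder q z' < zorder q z" if z: "q z = 0" for z
  proof (cases "n < m")
    case True
    have "int m * zorder q (z + c) < int m * zorder q z"
      unfolding ord[OF z, symmetric] using True pos[OF z] by simp
    then show ?thesis using iff[of z] z nm by (intro exI[of _ "z + c"]) simp
  next
    case False
    have z': "q (z - c) = 0" using iff[of "z - c"] z by simp
    have "int n * zorder q (z - c) < int n * zorder q z"
      using ord[OF z'] False nm pos[OF z] by simp
    then show ?thesis using z' nm by (intro exI[of _ "z - c"]) simp
  qed
  have "q z \<noteq> 0" if "nat (zorder q z) = k" for k z
    using that
  proof (induction k arbitrary: z rule: less_induct)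
    case (less k)
    show ?case
    proof
      assume z: "q z = 0"
      obtain z' where "q z' = 0" "zorder q z' < zorder q z" using smaller[OF z] by blast
      then show False using less.IH[of "nat (zorder q z')" z'] less.prems pos[OF z] by simp
    qed
  qed
  then show False using z by blast
qed

text \<open>
All statements about poles of \<open>f\<close> are made about zeros of an entire denominator \<open>q\<close> without
common zeros with the numerator \<open>P\<close>. After clearing denominators the equation holds everywhere, and
comparing orders at a zero of \<open>q\<close> relates \<open>q\<close> to its translate \<open>qc\<close>. For \<open>n \<noteq> m\<close> this excludes zeros; for \<open>n = m\<close> it
gives \<open>qc = k * q\<close> with a zero-free \<open>k\<close>, so that one denominator serves both \<open>f z\<close> and \<open>f (z + c)\<close>.
\<close>
lemma fermat_shift_constants:
  fixes f g :: "complex \<Rightarrow> complex"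
  assumes g: "g holomorphic_on UNIV" and f: "f nicely_meromorphic_on UNIV"
    and nonconst: "\<not> f constant_on UNIV"
    and n: "n \<ge> 2" and m: "m \<ge> 3" and nm: "(n, m) \<noteq> (3, 3)"
    and sol: "solves_fermat_shift n m c g f"
  obtains A B where "A \<noteq> 0" "B \<noteq> 0" "A ^ n + B ^ m = 1"
    "\<And>z. f z = A * exp (g z / of_nat n)" "\<And>z. f (z + c) = B * exp (g z / of_nat m)"
proof -
  obtain h f1 q where fac0: "h holomorphic_on UNIV" "f1 holomorphic_on UNIV" "q holomorphic_on UNIV"
    "\<forall>z. f1 z = 0 \<longleftrightarrow> \<not> is_pole f z \<and> f z = 0" "\<forall>z. q z = 0 \<longleftrightarrow> is_pole f z"
    "\<forall>z. h z \<noteq> 0" "\<forall>z. f z = h z * f1 z / q z"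
    by (rule weierstrass_factorization_meromorphic_UNIV[OF f])
  note fac = fac0(1-3) fac0(4-7)[rule_format]
  define P where "P = (\<lambda>z. h z * f1 z)"
  define Pc where "Pc = (\<lambda>z. P (z + c))"
  define qc where "qc = (\<lambda>z. q (z + c))"
  have P: "P holomorphic_on UNIV" unfolding P_def by (intro holomorphic_intros fac)
  have Pc: "Pc holomorphic_on UNIV" unfolding Pc_def by (rule holomorphic_on_translate[OF P])
  have qc: "qc holomorphic_on UNIV" unfolding qc_def by (rule holomorphic_on_translate[OF fac(3)])
  have fP: "f z = P z / q z" "f (z + c) = Pc z / qc z" for z by (simp_all add: P_def Pc_def qc_def fac(7))
  have cop: "P z \<noteq> 0" if "q z = 0" for z
    using that fac(4)[of z] fac(5)[of z] fac(6)[of z] by (simp add: P_def)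
  obtain w where w: "q w \<noteq> 0"
  proof -
    have "\<exists>w. q w \<noteq> 0"
    proof (rule ccontr)
      assume "\<nexists>w. q w \<noteq> 0"
      then have "f z = 0" for z by (simp add: fac(7))
      then show False using nonconst by (auto simp: constant_on_def)
    qed
    then show ?thesis using that by blast
  qed
  have wc: "qc (w - c) \<noteq> 0" using w by (simp add: qc_def)
  have nz: "eventually (\<lambda>z. q z \<noteq> 0) (at z)" "eventually (\<lambda>z. qc z \<noteq> 0) (at z)" for z
    using entire_eventually_nonzero[OF fac(3) w] entire_eventually_nonzero[OF qc wc] by blast+
  have "eventually (\<lambda>z. q z * qc z \<noteq> 0) (at 0)" using nz[of 0] by eventually_elim simp
  then obtain w2 where w2: "q w2 * qc w2 \<noteq> 0" using eventually_happens'[OF at_neq_bot] by blast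
  define E where "E = (\<lambda>z. P z ^ n * qc z ^ m + Pc z ^ m * q z ^ n - exp (g z) * q z ^ n * qc z ^ m)"
  have "E x = 0" for x
  proof (rule entire_eq_zero_off_zeros[where D = E and q = "\<lambda>z. q z * qc z" and w = w2])
    show "E holomorphic_on UNIV" unfolding E_def by (intro holomorphic_intros P Pc fac(3) qc g)
    fix z assume z: "q z * qc z \<noteq> 0"
    then have "\<not> is_pole f z" "\<not> is_pole f (z + c)" using fac(5)[of z] fac(5)[of "z + c"] by (auto simp: qc_def)
    then have "f z ^ n + f (z + c) ^ m = exp (g z)"
      using sol unfolding solves_fermat_shift_def by blast
    then have "(P z / q z) ^ n + (Pc z / qc z) ^ m = exp (g z)"
      by (simp only: fP(1)[of z] fP(2)[of z])
    then show "E z = 0"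
      unfolding E_def using z by (simp add: power_divide field_simps)
  qed (use w2 in \<open>auto intro!: holomorphic_intros fac(3) qc\<close>)
  then have eq: "P z ^ n * qc z ^ m + Pc z ^ m * q z ^ n = exp (g z) * q z ^ n * qc z ^ m" for z
    using fun_cong[OF E_def, of z] by simp
  have copc: "Pc z \<noteq> 0" if "qc z = 0" for z using cop[of "z + c"] that by (simp add: Pc_def qc_def)
  have pow0: "(0::complex) ^ n = 0" "(0::complex) ^ m = 0" using n m by simp_all
  have iff: "qc z = 0 \<longleftrightarrow> q z = 0" for z
  proof
    assume "q z = 0" then show "qc z = 0" using eq[of z] cop[of z] by (simp add: pow0)
  next
    assume "qc z = 0" then show "q z = 0" using eq[of z] copc[of z] by (simp add: pow0)
  qed
  have ord: "int n * zorder q z = int m * zorder qc z" if z: "q z = 0" for z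
  proof -
    \<comment> \<open>The cofactor of \<open>q ^ n\<close> in the equation \<open>q ^ n * X = P ^ n * qc ^ m\<close>; neither \<open>X\<close> nor \<open>P\<close> vanishes at a zero of \<open>q\<close>.\<close>
    define X where "X = (\<lambda>z. exp (g z) * qc z ^ m - Pc z ^ m)"
    have X: "X holomorphic_on UNIV" unfolding X_def by (intro holomorphic_intros g qc Pc)
    have qcz: "qc z = 0" using iff z by simp
    have Xz: "X z \<noteq> 0" unfolding X_def using qcz copc[OF qcz] by (simp add: pow0)
    have Pz: "P z ^ n \<noteq> 0" using cop[OF z] by simp
    have e: "q z ^ n * X z = P z ^ n * qc z ^ m" for z
      using eq[of z] by (simp add: X_def algebra_simps)
    have ev1: "eventually (\<lambda>z. q z ^ n * X z \<noteq> 0) (at z)"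
      using nz(1)[of z] entire_eventually_nonzero[OF X Xz, of z] by eventually_elim simp
    have ev2: "eventually (\<lambda>z. P z ^ n * qc z ^ m \<noteq> 0) (at z)"
      using nz(2)[of z] entire_eventually_nonzero[OF P cop[OF z], of z] by eventually_elim simp
    have "int n * zorder q z = zorder (\<lambda>z. q z ^ n) z + zorder X z"
      using entire_zorder_power[OF fac(3) w] zorder_eq_0I[OF entire_analytic_at[OF X] Xz] by simp
    also have "\<dots> = zorder (\<lambda>z. q z ^ n * X z) z"
      using ev1 by (intro zorder_times_analytic[symmetric] entire_analytic_at holomorphic_intros fac X)
    also have "\<dots> = zorder (\<lambda>z. P z ^ n * qc z ^ m) z" by (simp only: e)
    also have "\<dots> = zorder (\<lambda>z. P z ^ n) z + zorder (\<lambda>z. qc z ^ m) z"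
      using ev2 by (intro zorder_times_analytic entire_analytic_at holomorphic_intros P qc)
    also have "\<dots> = int m * zorder qc z"
      using entire_zorder_power[OF qc wc] zorder_eq_0I[OF entire_analytic_at[OF holomorphic_on_power[OF P]] Pz] by simp
    finally show ?thesis .
  qed
  have expn: "exp (g z / of_nat k) ^ k = exp (g z)" if "k > 0" for z k
    using that by (simp flip: exp_of_nat_mult)
  have "\<exists>A B. (\<forall>z. q z \<noteq> 0 \<and> f z = A * exp (g z / of_nat n) \<and> f (z + c) = B * exp (g z / of_nat m))"
  proof (cases "n = m")
    case False
    have q0: "q z \<noteq> 0" for z
      by (rule no_zeros_if_orders_scale[OF fac(3) w, of n m c])
         (use n m False iff ord in \<open>auto simp: qc_def zorder_translate\<close>)
    have qc0: "qc z \<noteq> 0" for z using q0 iff by blast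
    define F where "F = (\<lambda>z. P z / q z * exp (- (g z / of_nat n)))"
    define G where "G = (\<lambda>z. Pc z / qc z * exp (- (g z / of_nat m)))"
    have hol: "F holomorphic_on UNIV" "G holomorphic_on UNIV"
      unfolding F_def G_def by (intro holomorphic_intros P Pc fac qc g; use n m q0 qc0 in simp)+
    have "F z ^ n + G z ^ m = 1" for z
    proof -
      have "(P z / q z) ^ n + (Pc z / qc z) ^ m = exp (g z)"
        using eq[of z] q0[of z] qc0[of z] by (simp add: power_divide field_simps)
      moreover have "F z ^ n + G z ^ m = ((P z / q z) ^ n + (Pc z / qc z) ^ m) * inverse (exp (g z))"
        unfolding F_def G_def power_mult_distrib exp_minus power_inverse
        using expn n m by (simp add: distrib_right)
      ultimately show ?thesis by simp
    qed
    then have "F constant_on UNIV \<and> G constant_on UNIV"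
      by (rule entire_fermat_constant[OF hol n m])
    then obtain A B where "\<And>z. F z = A" "\<And>z. G z = B" by (auto simp: constant_on_def)
    moreover have "f z = F z * exp (g z / of_nat n)" "f (z + c) = G z * exp (g z / of_nat m)" for z
      unfolding fP(1)[of z] fP(2)[of z] F_def G_def by (simp_all add: exp_minus)
    ultimately show ?thesis using q0 by auto
  next
    case True
    then have n4: "n \<ge> 4" using m nm by auto
    have zo: "zorder q z = zorder qc z" for z
    proof (cases "q z = 0")
      case z: True
      then show ?thesis using ord[OF z] \<open>n = m\<close> n by simp
    next
      case False
      then show ?thesis
        using iff[of z] zorder_eq_0I[OF entire_analytic_at[OF fac(3)]] zorder_eq_0I[OF entire_analytic_at[OF qc]] by simp
    qed
    obtain k where k: "k holomorphic_on UNIV" "\<And>z. k z \<noteq> 0" "\<And>z. qc z = k z * q z"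
      using holomorphic_zorder_factorization[OF qc open_UNIV connected_UNIV fac(3)] iff zo by (metis UNIV_I)
    define a where "a = (\<lambda>z. P z * exp (- (g z / of_nat n)))"
    define b where "b = (\<lambda>z. Pc z / k z * exp (- (g z / of_nat n)))"
    have hol: "a holomorphic_on UNIV" "b holomorphic_on UNIV"
      unfolding a_def b_def by (intro holomorphic_intros P Pc k g; use n k in simp)+
    have "(\<lambda>z. a z ^ n + b z ^ n - q z ^ n) x = 0" for x
    proof (rule entire_eq_zero_off_zeros[OF _ fac(3) w, where D = "\<lambda>z. a z ^ n + b z ^ n - q z ^ n"])
      fix z assume qz: "q z \<noteq> 0"
      have "q z ^ n * (P z ^ n * k z ^ n + Pc z ^ n) = q z ^ n * (exp (g z) * q z ^ n * k z ^ n)"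
        using eq[of z] unfolding k(3) True[symmetric] by (simp add: power_mult_distrib algebra_simps)
      then have "P z ^ n * k z ^ n + Pc z ^ n = exp (g z) * q z ^ n * k z ^ n" using qz by simp
      then have "P z ^ n + (Pc z / k z) ^ n = exp (g z) * q z ^ n"
        using k(2)[of z] by (simp add: power_divide field_simps)
      moreover have "a z ^ n + b z ^ n = (P z ^ n + (Pc z / k z) ^ n) * inverse (exp (g z))"
        unfolding a_def b_def power_mult_distrib exp_minus power_inverse
        using expn[of n z] n by (simp add: distrib_right)
      ultimately show "a z ^ n + b z ^ n - q z ^ n = 0" by simp
    qed (intro holomorphic_intros hol fac)
    then have tri: "a z ^ n + b z ^ n = q z ^ n" for z by simp
    have nc: "\<not> (a z = 0 \<and> b z = 0)" for z
    proof
      assume "a z = 0 \<and> b z = 0"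
      then have "q z = 0" "P z = 0" using tri[of z] n by (auto simp: a_def pow0)
      then show False using cop by blast
    qed
    define A B where "A = a w / q w" and "B = b w / q w"
    have ab: "a z = A * q z" "b z = B * q z" for z
      unfolding A_def B_def
      by (rule wronskian_zero_imp_proportional[OF hol(1) fac(3) fermat_triple_wronskian_zero(1)[OF hol fac(3) n4 tri nc] w])
         (rule wronskian_zero_imp_proportional[OF hol(2) fac(3) fermat_triple_wronskian_zero(2)[OF hol fac(3) n4 tri nc] w])
    have q0: "q z \<noteq> 0" for z using nc[of z] ab[of z] by auto
    have "f z = A * exp (g z / of_nat n)" for z
    proof -
      have "P z = a z * exp (g z / of_nat n)" by (simp add: a_def exp_minus)
      then show ?thesis using q0[of z] by (simp add: fP(1)[of z] ab(1)[of z])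
    qed
    moreover have "f (z + c) = B * exp (g z / of_nat m)" for z
    proof -
      have "Pc z = b z * k z * exp (g z / of_nat n)" using k(2)[of z] by (simp add: b_def exp_minus)
      then show ?thesis using q0[of z] k(2)[of z] True by (simp add: fP(2)[of z] ab(2)[of z] k(3)[of z])
    qed
    ultimately show ?thesis using q0 by blast
  qed
  then obtain A B where AB: "\<And>z. q z \<noteq> 0" "\<And>z. f z = A * exp (g z / of_nat n)"
      "\<And>z. f (z + c) = B * exp (g z / of_nat m)" by blast
  have "A \<noteq> 0"
  proof
    assume "A = 0"
    then have "f z = 0" for z using AB(2) by simp
    then show False using nonconst by (auto simp: constant_on_def)
  qed
  moreover have "B \<noteq> 0"
  proof
    assume "B = 0"
    then have "f (z - c + c) = 0" for z unfolding AB(3) by simp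
    then show False using nonconst by (auto simp: constant_on_def)
  qed
  moreover have "A ^ n + B ^ m = 1"
  proof -
    have "f 0 ^ n + f (0 + c) ^ m = exp (g 0)"
      using sol AB(1) fac(5) unfolding solves_fermat_shift_def by blast
    then have "(A ^ n + B ^ m) * exp (g 0) = 1 * exp (g 0)"
      unfolding AB(2)[of 0] AB(3)[of 0] power_mult_distrib using expn n m by (simp add: distrib_right)
    then show ?thesis by (simp only: mult_cancel_right exp_not_eq_zero) simp
  qed
  ultimately show ?thesis using that AB(2,3) by blast
qed

section \<open>The proximity function\<close>

text \<open>
In this form continuity at the points where \<open>x = 0\<close> or \<open>x = 1\<close> is visible.
\<close>
lemma log_plus_eq_ln_max: "log_plus x = ln (max 1 x)" if "x \<ge> 0"
proof (cases "x \<ge> 1")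
  case False
  then have "ln x \<le> 0" using that by (cases "x = 0") auto
  then show ?thesis using False by (simp add: log_plus_def max_def)
qed (auto simp: log_plus_def max_def)

lemma log_plus_nonneg: "log_plus x \<ge> 0"
  by (simp add: log_plus_def)

lemma log_plus_mono: "0 \<le> x \<Longrightarrow> x \<le> y \<Longrightarrow> log_plus x \<le> log_plus y"
  by (simp add: log_plus_eq_ln_max)

lemma log_plus_add_le:
  assumes "x \<ge> 0" "y \<ge> 0"
  shows "log_plus (x + y) \<le> log_plus x + log_plus y + ln 2"
proof -
  have "x + y \<le> max 1 x * max 1 y + max 1 x * max 1 y"
  proof (rule add_mono)
    have "x * 1 \<le> max 1 x * max 1 y" by (rule mult_mono) (use assms in auto)
    then show "x \<le> max 1 x * max 1 y" by simp
    have "1 * y \<le> max 1 x * max 1 y" by (rule mult_mono) (use assms in auto)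
    then show "y \<le> max 1 x * max 1 y" by simp
  qed
  moreover have "1 * 1 \<le> max 1 x * max 1 y" by (rule mult_mono) auto
  ultimately have "max 1 (x + y) \<le> max 1 x * max 1 y * 2" by linarith
  then have "ln (max 1 (x + y)) \<le> ln (max 1 x * max 1 y * 2)"
    by (subst ln_le_cancel_iff) auto
  also have "\<dots> = ln (max 1 x) + ln (max 1 y) + ln 2"
    by (subst ln_mult ln_mult_pos; (simp add: ln_mult_pos)?)
  finally show ?thesis using assms by (simp add: log_plus_eq_ln_max)
qed

lemma continuous_on_log_plus_norm:
  assumes "continuous_on A f"
  shows "continuous_on A (\<lambda>x. log_plus (norm (f x)))"
proof -
  have "continuous_on A (\<lambda>x. ln (max 1 (norm (f x))))"
    by (intro continuous_intros assms) auto
  then show ?thesis by (simp add: log_plus_eq_ln_max)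
qed

lemma continuous_on_circle:
  assumes "continuous_on UNIV (H :: complex \<Rightarrow> 'a::topological_space)"
  shows "continuous_on A (\<lambda>\<theta>. H (of_real r * cis \<theta>))"
proof -
  have "continuous_on A (\<lambda>\<theta>. of_real r * cis \<theta>)" by (intro continuous_intros)
  from continuous_on_compose2[OF assms this] show ?thesis by simp
qed

lemma nev_integrable:
  assumes "continuous_on UNIV (H :: complex \<Rightarrow> complex)"
  shows "(\<lambda>\<theta>. log_plus (norm (H (of_real r * cis \<theta>)))) integrable_on {a..b}"
  by (intro integrable_continuous_real continuous_on_log_plus_norm continuous_on_circle assms)

lemma nev_proximity_nonneg:
  assumes "continuous_on UNIV (H :: complex \<Rightarrow> complex)"
  shows "nev_proximity r H \<ge> 0"
  unfolding nev_proximity_def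
  by (intro mult_nonneg_nonneg Henstock_Kurzweil_Integration.integral_nonneg nev_integrable assms)
     (auto simp: log_plus_nonneg)

lemma nev_proximity_le_add:
  fixes G H :: "complex \<Rightarrow> complex"
  assumes cont: "continuous_on UNIV G" "continuous_on UNIV H" and r: "r \<ge> 0" and M: "M \<ge> 0"
    and le: "\<And>z. norm z = r \<Longrightarrow> norm (H z) \<le> norm (G z) + M"
  shows "nev_proximity r H \<le> nev_proximity r G + log_plus M + ln 2"
proof -
  define I where "I = integral {0..2*pi} (\<lambda>\<theta>. log_plus (norm (G (of_real r * cis \<theta>))))"
  have "integral {0..2*pi} (\<lambda>\<theta>. log_plus (norm (H (of_real r * cis \<theta>))))
     \<le> integral {0..2*pi} (\<lambda>\<theta>. log_plus (norm (G (of_real r * cis \<theta>))) + (log_plus M + ln 2))"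
  proof (rule integral_le)
    fix \<theta>
    have "log_plus (norm (H (of_real r * cis \<theta>))) \<le> log_plus (norm (G (of_real r * cis \<theta>)) + M)"
      using r by (intro log_plus_mono le) (auto simp: norm_mult)
    also have "\<dots> \<le> log_plus (norm (G (of_real r * cis \<theta>))) + log_plus M + ln 2"
      using M by (intro log_plus_add_le) auto
    finally show "log_plus (norm (H (of_real r * cis \<theta>))) \<le> log_plus (norm (G (of_real r * cis \<theta>))) + (log_plus M + ln 2)"
      by simp
  qed (intro nev_integrable integrable_add integrable_const_ivl cont)+
  also have "\<dots> = I + 2 * pi * (log_plus M + ln 2)"
    unfolding I_def by (subst integral_add) (auto intro: nev_integrable cont)
  finally have "1 / (2*pi) * integral {0..2*pi} (\<lambda>\<theta>. log_plus (norm (H (of_real r * cis \<theta>))))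
     \<le> 1 / (2*pi) * (I + 2 * pi * (log_plus M + ln 2))"
    by (intro mult_left_mono) auto
  then show ?thesis unfolding nev_proximity_def I_def by (simp add: distrib_left)
qed

lemma nev_proximity_mono:
  fixes G H :: "complex \<Rightarrow> complex"
  assumes cont: "continuous_on UNIV G" "continuous_on UNIV H" and r: "r \<ge> 0"
    and le: "\<And>z. norm z = r \<Longrightarrow> norm (H z) \<le> norm (G z)"
  shows "nev_proximity r H \<le> nev_proximity r G"
  unfolding nev_proximity_def
  using r by (intro mult_left_mono integral_le nev_integrable cont log_plus_mono le) (auto simp: norm_mult)

text \<open>
An entire function has no poles, so its characteristic is the proximity function, and an order below
\<open>\<sigma> < 1\<close> bounds it by \<open>r powr \<sigma>\<close> for large \<open>r\<close>.
\<close>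
lemma nev_order_less_1_imp_slow:
  assumes hol: "g holomorphic_on UNIV" and ord: "nev_order g < 1"
  shows "((\<lambda>r. nev_proximity r g / r) \<longlongrightarrow> 0) at_top"
proof -
  have cont: "continuous_on UNIV g" using hol holomorphic_on_imp_continuous_on by blast
  have np: "\<not> is_pole g z" for z
    by (rule not_is_pole_holomorphic[of UNIV]) (use hol in auto)
  have T: "nev_characteristic r g = nev_proximity r g" for r
    by (simp add: nev_characteristic_def nev_counting_def nev_pole_count_def np)
  obtain \<sigma> where \<sigma>: "nev_order g < ereal \<sigma>" "ereal \<sigma> < 1" using ereal_dense2[OF ord] by blast
  have "eventually (\<lambda>r. ereal (ln (nev_characteristic r g) / ln r) < ereal \<sigma>) at_top"
    using \<sigma>(1) unfolding nev_order_def by (rule Limsup_lessD)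
  then have "eventually (\<lambda>r. nev_proximity r g / r \<le> r powr (\<sigma> - 1)) at_top"
    using eventually_gt_at_top[of 1]
  proof eventually_elim
    case (elim r)
    have l: "ln r > 0" using elim by simp
    have n0: "nev_proximity r g \<ge> 0" by (rule nev_proximity_nonneg[OF cont])
    have "nev_proximity r g \<le> r powr \<sigma>"
    proof (cases "nev_proximity r g = 0")
      case False
      then have pos: "nev_proximity r g > 0" using n0 by simp
      have "ln (nev_proximity r g) < \<sigma> * ln r" using elim l by (simp add: T field_simps)
      then have "exp (ln (nev_proximity r g)) \<le> exp (\<sigma> * ln r)" by simp
      then show ?thesis using pos elim by (simp add: powr_def)
    qed simp
    then have "nev_proximity r g / r \<le> r powr \<sigma> / r" using elim by (simp add: divide_right_mono)
    also have "\<dots> = r powr (\<sigma> - 1)" using elim by (simp add: powr_diff)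
    finally show ?case .
  qed
  moreover have "((\<lambda>r::real. r powr (\<sigma> - 1)) \<longlongrightarrow> 0) at_top"
    by (rule tendsto_neg_powr) (use \<sigma>(2) in \<open>auto simp: filterlim_ident\<close>)
  moreover have "eventually (\<lambda>r. 0 \<le> nev_proximity r g / r) at_top"
    using eventually_ge_at_top[of 0] by eventually_elim (auto intro!: divide_nonneg_nonneg nev_proximity_nonneg cont)
  ultimately show ?thesis by (rule tendsto_sandwich[rotated 2, OF tendsto_const, rotated -1]) 
qed

section \<open>Zeros and the proximity function\<close>

lemma periodic_integral_shift:
  fixes \<phi> :: "real \<Rightarrow> real"
  assumes cont: "continuous_on UNIV \<phi>" and per: "\<And>x. \<phi> (x + p) = \<phi> x" and s: "0 \<le> s" "s \<le> p"
  shows "integral {s..s+p} \<phi> = integral {0..p} \<phi>"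
proof -
  have int: "\<phi> integrable_on {a..b}" for a b
    using cont continuous_on_subset by (blast intro: integrable_continuous_real)
  have "integral {s..p} \<phi> + integral {p..s+p} \<phi> = integral {s..s+p} \<phi>"
    using s by (intro Henstock_Kurzweil_Integration.integral_combine int) auto
  moreover have "integral {p..s+p} \<phi> = integral {0..s} \<phi>"
    using integral_shift_Icc_real[of 0 s \<phi> p] by (simp add: o_def per add.commute)
  moreover have "integral {0..s} \<phi> + integral {s..p} \<phi> = integral {0..p} \<phi>"
    using s by (intro Henstock_Kurzweil_Integration.integral_combine int) auto
  ultimately show ?thesis by simp
qed

text \<open>
Riemann sums of a periodic function over equidistant points approach its mean uniformly in the starting point
\<open>s\<close>; the upper estimate is the half that is needed below.
\<close>
lemma periodic_equidistant_sum_le: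
  fixes \<phi> :: "real \<Rightarrow> real"
  assumes cont: "continuous_on UNIV \<phi>" and per: "\<And>x. \<phi> (x + p) = \<phi> x" and p: "p > 0" and e: "e > 0"
  obtains N where "N \<ge> 1" "\<And>s. 0 \<le> s \<Longrightarrow> s \<le> p \<Longrightarrow>
    (\<Sum>j<N. \<phi> (s + p * real j / real N)) \<le> real N * (integral {0..p} \<phi> / p + e)"
proof -
  have int: "\<phi> integrable_on {a..b}" for a b
    using cont continuous_on_subset by (blast intro: integrable_continuous_real)
  have "uniformly_continuous_on {0..2*p} \<phi>"
    using cont continuous_on_subset by (blast intro: compact_uniformly_continuous compact_Icc)
  then obtain \<delta> where \<delta>: "\<delta> > 0"
    "\<And>x y. x \<in> {0..2*p} \<Longrightarrow> y \<in> {0..2*p} \<Longrightarrow> dist x y < \<delta> \<Longrightarrow> dist (\<phi> x) (\<phi> y) < e"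
    unfolding uniformly_continuous_on_def using e by metis
  obtain N where N: "real N > p / \<delta>" using reals_Archimedean2 by blast
  then have "real N > 0" using p \<delta>(1) by (meson divide_pos_pos less_trans)
  then have N0: "N \<ge> 1" by simp
  define d where "d = p / real N"
  have d: "d > 0" "d < \<delta>" "real N * d = p" using N p \<delta>(1) N0 by (auto simp: d_def field_simps)
  show ?thesis
  proof (rule that[OF N0])
    fix s assume s: "0 \<le> s" "s \<le> p"
    have "d * (\<Sum>j<k. \<phi> (s + real j * d)) \<le> integral {s..s + real k * d} \<phi> + real k * d * e" if "k \<le> N" for k
      using that
    proof (induction k)
      case (Suc k)
      let ?a = "s + real k * d" and ?b = "s + real (Suc k) * d"
      have ab: "?a \<le> ?b" "?b - ?a = d" using d by (auto simp: algebra_simps)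
      have "real (Suc k) * d \<le> real N * d" using Suc.prems d by (intro mult_right_mono) auto
      then have b2: "?b \<le> 2 * p" using s d by simp
      have a0: "0 \<le> ?a" using s d by simp
      have "integral {?a..?b} (\<lambda>_. \<phi> ?a - e) \<le> integral {?a..?b} \<phi>"
      proof (rule integral_le)
        fix x assume x: "x \<in> {?a..?b}"
        then have "dist x ?a < \<delta>" using ab d by (auto simp: dist_real_def)
        then have "dist (\<phi> x) (\<phi> ?a) < e" using x a0 b2 ab by (intro \<delta>) auto
        then show "\<phi> ?a - e \<le> \<phi> x" by (auto simp: dist_real_def)
      qed (intro int integrable_const_ivl)+
      then have 1: "d * \<phi> ?a - d * e \<le> integral {?a..?b} \<phi>" using ab by (simp add: right_diff_distrib)
      have 2: "integral {s..?a} \<phi> + integral {?a..?b} \<phi> = integral {s..?b} \<phi>"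
        using d ab by (intro Henstock_Kurzweil_Integration.integral_combine int) auto
      have IH: "d * (\<Sum>j<k. \<phi> (s + real j * d)) \<le> integral {s..?a} \<phi> + real k * d * e"
        using Suc by simp
      have "d * (\<Sum>j<Suc k. \<phi> (s + real j * d)) = d * (\<Sum>j<k. \<phi> (s + real j * d)) + d * \<phi> ?a"
        by (simp add: distrib_left)
      also have "\<dots> \<le> integral {s..?b} \<phi> + (real k * d * e + d * e)" using 1 2 IH by linarith
      also have "real k * d * e + d * e = real (Suc k) * d * e" by (simp add: algebra_simps)
      finally show ?case .
    qed simp
    from this[of N] have "d * (\<Sum>j<N. \<phi> (s + real j * d)) \<le> integral {0..p} \<phi> + p * e"
      using periodic_integral_shift[OF cont per s] d by simp
    also have "\<dots> = d * (real N * (integral {0..p} \<phi> / p + e))"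
      using d(3) p N0 by (simp add: d_def field_simps)
    finally have "(\<Sum>j<N. \<phi> (s + real j * d)) \<le> real N * (integral {0..p} \<phi> / p + e)"
      using d by simp
    then show "(\<Sum>j<N. \<phi> (s + p * real j / real N)) \<le> real N * (integral {0..p} \<phi> / p + e)"
      by (simp add: d_def mult.commute)
  qed
qed

text \<open>
The mean value inequality for the subharmonic function \<open>log\<^sup>+ |H|\<close>, without any discussion of zeros of
\<open>H\<close> on the circle. The product of the \<open>N\<close> rotated copies \<open>H (z * cis (2 * pi * j / N))\<close> is
holomorphic with value \<open>H 0 ^ N\<close> at the origin. By the maximum modulus principle some point of the circle has
a product at least as large, and its logarithm is a sum over equidistant points of the circle, that is, almost
\<open>N\<close> times the mean.
\<close>
lemma log_plus_center_le_nev_proximity: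
  fixes H :: "complex \<Rightarrow> complex"
  assumes hol: "H holomorphic_on UNIV" and r: "r > 0"
  shows "log_plus (norm (H 0)) \<le> nev_proximity r H"
proof (cases "norm (H 0) > 1")
  case False
  then have "log_plus (norm (H 0)) = 0" by (simp add: log_plus_eq_ln_max max_def)
  then show ?thesis
    using nev_proximity_nonneg[OF holomorphic_on_imp_continuous_on[OF hol]] by simp
next
  case True
  have cont: "continuous_on A H" for A using hol holomorphic_on_imp_continuous_on continuous_on_subset by blast
  define \<phi> where "\<phi> = (\<lambda>\<theta>. log_plus (norm (H (of_real r * cis \<theta>))))"
  have \<phi>c: "continuous_on UNIV \<phi>" unfolding \<phi>_def
    by (intro continuous_on_log_plus_norm continuous_on_circle cont)
  have \<phi>p: "\<phi> (x + 2 * pi) = \<phi> x" for x unfolding \<phi>_def by (simp flip: cis_mult)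
  have "log_plus (norm (H 0)) \<le> nev_proximity r H + e" if e: "e > 0" for e
  proof -
    obtain N where N: "N \<ge> 1" "\<And>s. 0 \<le> s \<Longrightarrow> s \<le> 2 * pi \<Longrightarrow>
       (\<Sum>j<N. \<phi> (s + 2 * pi * real j / real N)) \<le> real N * (integral {0..2 * pi} \<phi> / (2 * pi) + e)"
      using periodic_equidistant_sum_le[OF \<phi>c \<phi>p _ e] by auto
    define HN where "HN = (\<lambda>z. \<Prod>j<N. H (z * cis (2 * pi * real j / real N)))"
    have "(\<lambda>z. H (z * k)) holomorphic_on UNIV" for k
      using holomorphic_on_compose_gen[OF _ hol, of "\<lambda>z. z * k" UNIV] by (simp add: o_def holomorphic_intros)
    then have HNh: "HN holomorphic_on UNIV" unfolding HN_def by (intro holomorphic_on_prod)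
    have HNc: "continuous_on A HN" for A using HNh holomorphic_on_imp_continuous_on continuous_on_subset by blast
    have "continuous_on (sphere 0 r) (\<lambda>z. norm (HN z))" by (intro continuous_intros HNc)
    then obtain \<xi> where \<xi>: "\<xi> \<in> sphere 0 r" "\<And>z. z \<in> sphere 0 r \<Longrightarrow> norm (HN z) \<le> norm (HN \<xi>)"
      using continuous_attains_sup[of "sphere (0::complex) r" "\<lambda>z. norm (HN z)"] r
      by (metis compact_sphere sphere_eq_empty not_less_iff_gr_or_eq)
    have "norm (HN 0) \<le> norm (HN \<xi>)"
      by (rule maximum_modulus_frontier[of HN "ball 0 r"])
         (use \<xi> r HNc HNh holomorphic_on_subset in auto)
    moreover have "norm (HN 0) = norm (H 0) ^ N" by (simp add: HN_def norm_power)
    ultimately have le: "norm (H 0) ^ N \<le> norm (HN \<xi>)" by simp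
    have "norm (H 0) > 0" using True by linarith
    then have "norm (H 0) ^ N > 0" by (rule zero_less_power)
    then have HN\<xi>: "HN \<xi> \<noteq> 0" using le by auto
    define s where "s = Arg2pi \<xi>"
    have s: "0 \<le> s" "s \<le> 2 * pi" "\<xi> = of_real r * cis s"
      using Arg2pi[of \<xi>] \<xi>(1) by (auto simp: s_def cis_conv_exp is_Arg_def)
    have pt: "\<xi> * cis (2 * pi * real j / real N) = of_real r * cis (s + 2 * pi * real j / real N)" for j
      by (simp add: s(3) cis_mult mult.assoc)
    have nzf: "H (\<xi> * cis (2 * pi * real j / real N)) \<noteq> 0" if "j < N" for j
      using HN\<xi> that unfolding HN_def by auto
    have "real N * ln (norm (H 0)) = ln (norm (H 0) ^ N)" using True by (simp add: ln_realpow)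
    also have "\<dots> \<le> ln (norm (HN \<xi>))" using le \<open>norm (H 0) ^ N > 0\<close> by (subst ln_le_cancel_iff) auto
    also have "\<dots> = (\<Sum>j<N. ln (norm (H (\<xi> * cis (2 * pi * real j / real N)))))"
      unfolding HN_def prod_norm[symmetric] by (rule ln_prod) (use nzf in auto)
    also have "\<dots> \<le> (\<Sum>j<N. \<phi> (s + 2 * pi * real j / real N))"
      unfolding \<phi>_def pt by (intro sum_mono) (simp add: log_plus_def)
    also have "\<dots> \<le> real N * (nev_proximity r H + e)"
      using N(2)[OF s(1,2)] by (simp add: nev_proximity_def \<phi>_def)
    finally have "ln (norm (H 0)) \<le> nev_proximity r H + e" using N(1) by simp
    then show ?thesis using True by (simp add: log_plus_def)
  qed
  then show ?thesis by (rule field_le_epsilon)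
qed

lemma entire_factor_finite_zeros:
  fixes G :: "complex \<Rightarrow> complex"
  assumes "finite S" "G holomorphic_on UNIV" "\<And>a. a \<in> S \<Longrightarrow> G a = 0"
  obtains G1 where "G1 holomorphic_on UNIV" "\<And>z. G z = (\<Prod>a\<in>S. z - a) * G1 z"
  using assms(1,3)
proof (induction S arbitrary: thesis rule: finite_induct)
  case empty
  then show ?case using assms(2) by simp
next
  case (insert a S)
  obtain G1 where G1: "G1 holomorphic_on UNIV" "\<And>z. G z = (\<Prod>a\<in>S. z - a) * G1 z"
    using insert.IH insert.prems(2) by blast
  have "(\<Prod>x\<in>S. a - x) \<noteq> 0" using insert.hyps by auto
  then have G1a: "G1 a = 0" using G1(2)[of a] insert.prems(2)[of a] by simp
  define G2 where "G2 = (\<lambda>z. if z = a then deriv G1 a else (G1 z - G1 a) / (z - a))"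
  have "G2 holomorphic_on UNIV" unfolding G2_def by (rule pole_lemma_open[OF G1(1)]) simp
  moreover have "G1 z = (z - a) * G2 z" for z using G1a by (auto simp: G2_def)
  then have "G z = (\<Prod>x\<in>insert a S. z - x) * G2 z" for z
    using G1(2)[of z] insert.hyps by simp
  ultimately show ?case using insert.prems(1) by blast
qed

text \<open>
A weak form of Jensen's formula. Replacing each factor \<open>z - a\<close> by \<open>(r^2 - cnj a * z) / r\<close> leaves the
modulus unchanged on the circle of radius \<open>r\<close>, and multiplies the modulus at the origin by \<open>r / |a| \<ge> 2\<close>.
\<close>
lemma zeros_le_nev_proximity:
  fixes G :: "complex \<Rightarrow> complex"
  assumes hol: "G holomorphic_on UNIV" and G0: "G 0 \<noteq> 0" and S: "finite S"
    and z: "\<And>a. a \<in> S \<Longrightarrow> G a = 0" and r: "r > 0" "\<And>a. a \<in> S \<Longrightarrow> 2 * norm a \<le> r"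
  shows "real (card S) * ln 2 + ln (norm (G 0)) \<le> nev_proximity r G"
proof -
  obtain G1 where G1: "G1 holomorphic_on UNIV" "\<And>z. G z = (\<Prod>a\<in>S. z - a) * G1 z"
    using entire_factor_finite_zeros[OF S hol z] by blast
  define H where "H = (\<lambda>z. G1 z * (\<Prod>a\<in>S. (of_real (r^2) - cnj a * z) / of_real r))"
  have Hh: "H holomorphic_on UNIV" unfolding H_def by (intro holomorphic_intros G1) (use r in auto)
  have eq: "norm (H w) = norm (G w)" if w: "norm w = r" for w
  proof -
    have "norm ((of_real (r^2) - cnj a * w) / of_real r) = norm (w - a)" for a
    proof -
      have "of_real (r^2) = w * cnj w" using complex_norm_square[of w] w by simp
      then have "of_real (r^2) - cnj a * w = w * cnj (w - a)" by (simp add: algebra_simps)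
      then have "norm (of_real (r^2) - cnj a * w) = r * norm (w - a)" by (metis norm_mult complex_mod_cnj w)
      then show ?thesis using r by (simp add: norm_divide)
    qed
    then show ?thesis unfolding H_def G1(2)[of w] by (simp add: norm_mult flip: prod_norm)
  qed
  have "nev_proximity r H = nev_proximity r G"
    unfolding nev_proximity_def using r eq by (simp add: norm_mult)
  then have le: "log_plus (norm (H 0)) \<le> nev_proximity r G"
    using log_plus_center_le_nev_proximity[OF Hh r(1)] by simp
  have G10: "G1 0 \<noteq> 0" using G1(2)[of 0] G0 by auto
  have "norm (G 0) = (\<Prod>a\<in>S. norm a) * norm (G1 0)" unfolding G1(2)[of 0] by (simp add: norm_mult flip: prod_norm)
  also have "\<dots> \<le> (\<Prod>a\<in>S. r / 2) * norm (G1 0)"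
    using r by (intro mult_right_mono prod_mono) (auto simp: field_simps)
  finally have g: "2 ^ card S * norm (G 0) \<le> r ^ card S * norm (G1 0)" by (simp add: power_divide field_simps)
  have "norm (H 0) = r ^ card S * norm (G1 0)"
    unfolding H_def using r by (simp add: norm_mult norm_power power2_eq_square)
  then have "2 ^ card S * norm (G 0) \<le> norm (H 0)" using g by simp
  moreover have "2 ^ card S * norm (G 0) > 0" using G0 by simp
  ultimately have "ln (2 ^ card S * norm (G 0)) \<le> ln (norm (H 0))"
    by (subst ln_le_cancel_iff) linarith+
  also have "\<dots> \<le> log_plus (norm (H 0))" by (simp add: log_plus_def)
  also note le
  finally show ?thesis using G0 by (simp add: ln_mult_pos ln_realpow)
qed

section \<open>Entire functions of slow growth under a shift\<close>

lemma entire_factor_zero_at_origin: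
  fixes G :: "complex \<Rightarrow> complex"
  assumes hol: "G holomorphic_on UNIV" and nz: "G w \<noteq> 0"
  obtains p :: nat and G1 where "G1 holomorphic_on UNIV" "G1 0 \<noteq> 0" "\<And>z. G z = z ^ p * G1 z"
proof -
  define p where "p = nat (zorder G 0)"
  have "\<exists>w\<in>UNIV. G w \<noteq> 0" using nz by blast
  note exist = conjunct2[OF zorder_exist_zero[OF hol open_UNIV connected_UNIV UNIV_I this, of 0]]
  obtain r where r: "r > 0" "zor_poly G 0 holomorphic_on cball 0 r"
     "\<And>z. z \<in> cball 0 r \<Longrightarrow> G z = zor_poly G 0 z * z ^ p \<and> zor_poly G 0 z \<noteq> 0"
    using exist by (auto simp: p_def)
  define G1 where "G1 = (\<lambda>z. if z = 0 then zor_poly G 0 z else G z / z ^ p)"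
  have G1b: "G1 z = zor_poly G 0 z" if "z \<in> cball 0 r" for z
    using r(3)[OF that] by (auto simp: G1_def)
  have "G1 holomorphic_on (ball 0 r \<union> (- {0}))"
  proof (rule holomorphic_on_Un)
    show "G1 holomorphic_on ball 0 r"
      by (rule holomorphic_transform[OF holomorphic_on_subset[OF r(2)]]) (use G1b in auto)
    have "(\<lambda>z. G z / z ^ p) holomorphic_on - {0}"
      by (intro holomorphic_intros holomorphic_on_subset[OF hol]) auto
    then show "G1 holomorphic_on - {0}" by (rule holomorphic_transform) (auto simp: G1_def)
  qed auto
  also have "ball 0 r \<union> (- {0}) = (UNIV :: complex set)" using r(1) by auto
  finally have "G1 holomorphic_on UNIV" .
  moreover have "G1 0 \<noteq> 0" using r(1) r(3)[of 0] G1b[of 0] by simp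
  moreover have "G z = z ^ p * G1 z" for z
    using r(1) r(3)[of 0] by (cases "z = 0") (auto simp: G1_def)
  ultimately show ?thesis by (rule that)
qed

text \<open>
The disc of radius \<open>r / 2\<close> contains about \<open>r / (2 * |c|)\<close> of the zeros \<open>z1 + k * c\<close>, so that a nonzero \<open>G\<close>
has a proximity function of at least linear growth.
\<close>
lemma slow_entire_zero_progression:
  fixes G :: "complex \<Rightarrow> complex"
  assumes hol: "G holomorphic_on UNIV" and c: "c \<noteq> 0"
    and zeros: "\<And>k::nat. G (z1 + of_nat k * c) = 0"
    and slow: "((\<lambda>r. nev_proximity r G / r) \<longlongrightarrow> 0) at_top"
  shows "G w = 0"
proof (rule ccontr)
  assume nz: "G w \<noteq> 0"
  obtain p G1 where G1: "G1 holomorphic_on UNIV" "G1 0 \<noteq> 0" "\<And>z. G z = z ^ p * G1 z"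
    using entire_factor_zero_at_origin[OF hol nz] by blast
  have cont: "continuous_on UNIV G" "continuous_on UNIV G1"
    using hol G1(1) holomorphic_on_imp_continuous_on by blast+
  have mono: "nev_proximity r G1 \<le> nev_proximity r G" if "r \<ge> 1" for r
  proof (rule nev_proximity_mono[OF cont])
    show "norm (G1 z) \<le> norm (G z)" if "norm z = r" for z
    proof -
      have "1 * norm (G1 z) \<le> norm z ^ p * norm (G1 z)"
        using that \<open>r \<ge> 1\<close> by (intro mult_right_mono one_le_power) auto
      then show ?thesis by (simp add: G1(3) norm_mult norm_power)
    qed
  qed (use that in auto)
  have nc: "norm c > 0" using c by simp
  \<comment> \<open>From index \<open>k0\<close> on the progression avoids the origin, so that dividing by \<open>z ^ p\<close> keeps its zeros.\<close>
  obtain k0 :: nat where k0: "norm z1 < real k0 * norm c"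
    using reals_Archimedean3[OF nc] by blast
  define a where "a = (\<lambda>k::nat. z1 + of_nat (k0 + k) * c)"
  have a0: "a k \<noteq> 0" for k
  proof
    assume "a k = 0"
    then have "norm z1 = real (k0 + k) * norm c"
      by (metis a_def add_eq_0_iff norm_minus_cancel norm_mult norm_of_nat)
    then show False using k0 nc mult_right_mono[of "real k0" "real (k0+k)" "norm c"] by simp
  qed
  have inj: "inj a" using c by (auto simp: a_def inj_def)
  have G1a: "G1 (a k) = 0" for k
    using zeros[of "k0 + k"] G1(3)[of "a k"] a0[of k] by (simp add: a_def)
  define R where "R = 2 * norm z1 + 2 * real k0 * norm c + 1"
  have Nbound: "real N * ln 2 + ln (norm (G1 0)) \<le> nev_proximity (R + 2 * real N * norm c) G" for N
  proof -
    let ?r = "R + 2 * real N * norm c"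
    have r1: "?r \<ge> 1" unfolding R_def by simp
    have "real (card (a ` {..<N})) * ln 2 + ln (norm (G1 0)) \<le> nev_proximity ?r G1"
    proof (rule zeros_le_nev_proximity[OF G1(1,2)])
      fix x assume "x \<in> a ` {..<N}"
      then obtain k where k: "x = a k" "k < N" by auto
      have "norm x \<le> norm z1 + real (k0 + k) * norm c"
        unfolding k a_def by (metis norm_triangle_ineq norm_mult norm_of_nat)
      also have "real (k0 + k) * norm c \<le> real (k0 + N) * norm c" using k by (intro mult_right_mono) auto
      finally show "2 * norm x \<le> ?r" unfolding R_def by (simp add: algebra_simps)
    qed (use G1a r1 in auto)
    moreover have "card (a ` {..<N}) = N" using inj by (subst card_image) (auto intro: inj_on_subset)
    ultimately show ?thesis using mono[OF r1] by simp
  qed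
  \<comment> \<open>Half of the growth rate \<open>ln 2 / (2 * |c|)\<close> which \<open>Nbound\<close> forces.\<close>
  define \<epsilon> where "\<epsilon> = ln 2 / (4 * norm c)"
  have \<epsilon>: "\<epsilon> > 0" unfolding \<epsilon>_def using nc by simp
  have "eventually (\<lambda>r. nev_proximity r G / r < \<epsilon>) at_top"
    using order_tendstoD(2)[OF slow \<epsilon>] .
  then obtain r0 where r0: "\<And>r. r \<ge> r0 \<Longrightarrow> nev_proximity r G / r < \<epsilon>"
    unfolding eventually_at_top_linorder by blast
  define B where "B = \<epsilon> * R - ln (norm (G1 0))"
  obtain N :: nat where N: "real N > max (r0 / (2 * norm c)) (2 * B / ln 2)"
    using reals_Archimedean2 by blast
  let ?r = "R + 2 * real N * norm c"
  have rpos: "?r \<ge> 1" unfolding R_def by simp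
  have "r0 < 2 * real N * norm c" using N nc by (simp add: field_simps)
  moreover have "R \<ge> 1" unfolding R_def by simp
  ultimately have "?r \<ge> r0" by linarith
  then have "nev_proximity ?r G < \<epsilon> * ?r" using r0[of ?r] rpos by (simp add: field_simps)
  then have "real N * ln 2 + ln (norm (G1 0)) < \<epsilon> * ?r" using Nbound[of N] by linarith
  also have "\<epsilon> * ?r = \<epsilon> * R + real N * ln 2 / 2" unfolding \<epsilon>_def using nc by (simp add: field_simps)
  finally have "real N * ln 2 / 2 < B" unfolding B_def by (simp add: field_simps)
  moreover have "B < real N * ln 2 / 2" using N by (simp add: field_simps)
  ultimately show False by simp
qed

text \<open>
Cauchy's formulas for the Taylor coefficients and Cauchy's theorem, read as Fourier coefficients on a circle.
\<close>
lemma circle_fourier_coefficients: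
  fixes h :: "complex \<Rightarrow> complex"
  assumes hol: "h holomorphic_on UNIV" and r: "r > 0"
  shows "((\<lambda>t. h (of_real r * cis t)) has_integral 2 * pi * h 0) {0..2*pi}"
    and "((\<lambda>t. h (of_real r * cis t) * cis (- (real (Suc k) * t))) has_integral
            2 * pi * (of_real r ^ Suc k * (deriv ^^ Suc k) h 0 / fact (Suc k))) {0..2*pi}"
    and "((\<lambda>t. h (of_real r * cis t) * cis (real (Suc k) * t)) has_integral 0) {0..2*pi}"
proof -
  have cont: "continuous_on A h" for A using hol holomorphic_on_imp_continuous_on continuous_on_subset by blast
  have gen: "((\<lambda>t. h (of_real r * cis t) * cis (- (real j * t))) has_integral
            2 * pi * (of_real r ^ j * (deriv ^^ j) h 0 / fact j)) {0..2*pi}" for j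
  proof -
    have "((\<lambda>u. h u / (u - 0) ^ Suc j) has_contour_integral ((2 * pi * \<i>) / fact j * (deriv ^^ j) h 0)) (circlepath 0 r)"
      by (rule Cauchy_has_contour_integral_higher_derivative_circlepath)
         (use r cont hol holomorphic_on_subset in auto)
    then have "((\<lambda>t. h (0 + of_real r * cis t) / (0 + of_real r * cis t - 0) ^ Suc j * of_real r * \<i> * cis t)
        has_integral ((2 * pi * \<i>) / fact j * (deriv ^^ j) h 0)) {0..2*pi}"
      unfolding circlepath_def by (subst (asm) has_contour_integral_part_circlepath_iff) auto
    then have "((\<lambda>t. - \<i> * of_real r ^ j * (h (0 + of_real r * cis t) / (0 + of_real r * cis t - 0) ^ Suc j * of_real r * \<i> * cis t))
        has_integral - \<i> * of_real r ^ j * ((2 * pi * \<i>) / fact j * (deriv ^^ j) h 0)) {0..2*pi}"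
      by (rule has_integral_mult_right)
    moreover have "- \<i> * of_real r ^ j * (h (0 + of_real r * cis t) / (0 + of_real r * cis t - 0) ^ Suc j * of_real r * \<i> * cis t)
       = h (of_real r * cis t) * cis (- (real j * t))" for t
    proof -
      have "cis (- (real j * t)) = inverse (cis t ^ j)" by (simp add: Complex.DeMoivre)
      then show ?thesis using r by (simp add: power_mult_distrib field_simps)
    qed
    moreover have "- \<i> * of_real r ^ j * ((2 * pi * \<i>) / fact j * (deriv ^^ j) h 0) = 2 * pi * (of_real r ^ j * (deriv ^^ j) h 0 / fact j)"
      by (simp add: field_simps)
    ultimately show ?thesis by simp
  qed
  show "((\<lambda>t. h (of_real r * cis t)) has_integral 2 * pi * h 0) {0..2*pi}"
    using gen[of 0] by simp
  show "((\<lambda>t. h (of_real r * cis t) * cis (- (real (Suc k) * t))) has_integral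
            2 * pi * (of_real r ^ Suc k * (deriv ^^ Suc k) h 0 / fact (Suc k))) {0..2*pi}"
    by (rule gen)
  have "((\<lambda>u. h u * u ^ k) has_contour_integral 0) (circlepath 0 r)"
    by (rule Cauchy_theorem_disc_simple[of _ 0 "r + 1"])
       (use r hol holomorphic_on_subset in \<open>auto intro!: holomorphic_intros\<close>)
  then have "((\<lambda>t. h (0 + of_real r * cis t) * (0 + of_real r * cis t) ^ k * of_real r * \<i> * cis t) has_integral 0) {0..2*pi}"
    unfolding circlepath_def by (subst (asm) has_contour_integral_part_circlepath_iff) auto
  then have "((\<lambda>t. - \<i> / of_real r ^ Suc k * (h (0 + of_real r * cis t) * (0 + of_real r * cis t) ^ k * of_real r * \<i> * cis t)) has_integral
      - \<i> / of_real r ^ Suc k * 0) {0..2*pi}"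
    by (rule has_integral_mult_right)
  moreover have "- \<i> / of_real r ^ Suc k * (h (0 + of_real r * cis t) * (0 + of_real r * cis t) ^ k * of_real r * \<i> * cis t)
       = h (of_real r * cis t) * cis (real (Suc k) * t)" for t
  proof -
    have "cis (real (Suc k) * t) = cis t ^ Suc k" by (simp only: Complex.DeMoivre)
    then show ?thesis using r by (simp add: power_mult_distrib field_simps del: of_nat_Suc)
  qed
  ultimately show "((\<lambda>t. h (of_real r * cis t) * cis (real (Suc k) * t)) has_integral 0) {0..2*pi}"
    by simp
qed

text \<open>
The proximity function of \<open>exp h\<close> is the mean of the positive part of \<open>Re h\<close>. Integrating \<open>Re h\<close> against
the kernel \<open>1 + Re (\<eta> * cis (- k * t))\<close>, which takes values between \<open>0\<close> and \<open>2\<close>, gives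
at most twice that mean, while by Fourier analysis it produces \<open>|A| * r ^ k / 2\<close>, where \<open>A\<close> is the \<open>k\<close>-th Taylor
coefficient of \<open>h\<close> and \<open>\<eta>\<close> rotates \<open>A\<close> to the positive axis.
\<close>
lemma slow_exp_imp_constant:
  fixes h :: "complex \<Rightarrow> complex"
  assumes hol: "h holomorphic_on UNIV"
    and slow: "((\<lambda>r. nev_proximity r (\<lambda>z. exp (h z)) / r) \<longlongrightarrow> 0) at_top"
  shows "h w = h 0"
proof (rule holomorphic_fun_eq_const_on_connected[OF hol])
  fix k :: nat assume "k > 0"
  then obtain j where j: "k = Suc j" by (cases k) auto
  define A where "A = (deriv ^^ k) h 0 / fact k"
  have cont: "continuous_on UNIV h" using hol holomorphic_on_imp_continuous_on by blast
  have bound: "norm A \<le> 4 * (nev_proximity r (\<lambda>z. exp (h z)) / r) - 2 * Re (h 0) / r" if r: "r \<ge> 1" for r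
  proof -
    define \<eta> where "\<eta> = (if A = 0 then 1 else cnj A / of_real (norm A))"
    have "cnj A * A = of_real (norm A) ^ 2" using complex_norm_square[of A] by (simp add: mult.commute)
    then have \<eta>: "norm \<eta> = 1" "\<eta> * A = of_real (norm A)"
      by (auto simp: \<eta>_def norm_divide power2_eq_square)
    have r0: "r > 0" using r by simp
    note F1 = circle_fourier_coefficients(1)[OF hol r0]
    have F2: "((\<lambda>t. h (of_real r * cis t) * cis (- (real k * t))) has_integral
            2 * pi * (of_real r ^ k * (deriv ^^ k) h 0 / fact k)) {0..2*pi}"
      unfolding j by (rule circle_fourier_coefficients(2)[OF hol r0])
    have F3: "((\<lambda>t. h (of_real r * cis t) * cis (real k * t)) has_integral 0) {0..2*pi}"
      unfolding j by (rule circle_fourier_coefficients(3)[OF hol r0])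
    define L where "L = (\<lambda>t. h (of_real r * cis t) + (\<eta> * (h (of_real r * cis t) * cis (- (real k * t)))
          + cnj \<eta> * (h (of_real r * cis t) * cis (real k * t))) / 2)"
    have "(L has_integral (2 * pi * h 0 + (\<eta> * (2 * pi * (of_real r ^ k * (deriv ^^ k) h 0 / fact k)) + cnj \<eta> * 0) / 2)) {0..2*pi}"
      unfolding L_def
      by (rule has_integral_add[OF F1 has_integral_divide[OF has_integral_add[OF
            has_integral_mult_right[OF F2] has_integral_mult_right[OF F3]]]])
    also have "2 * pi * h 0 + (\<eta> * (2 * pi * (of_real r ^ k * (deriv ^^ k) h 0 / fact k)) + cnj \<eta> * 0) / 2
        = of_real (2 * pi) * h 0 + of_real (pi * r ^ k) * (\<eta> * A)" by (simp add: A_def)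
    finally have "(L has_integral of_real (2 * pi) * h 0 + of_real (pi * r ^ k) * of_real (norm A)) {0..2*pi}"
      unfolding \<eta>(2) .
    from has_integral_Re[OF this] have I1: "((\<lambda>t. Re (L t)) has_integral 2 * pi * Re (h 0) + pi * r ^ k * norm A) {0..2*pi}"
      by (simp flip: of_real_power of_real_mult)
    define U where "U = (\<lambda>t. 2 * log_plus (norm (exp (h (of_real r * cis t)))))"
    have "(\<lambda>\<theta>. log_plus (norm (exp (h (of_real r * cis \<theta>))))) integrable_on {0..2*pi}"
      by (rule nev_integrable[of "\<lambda>z. exp (h z)"]) (intro continuous_intros cont)
    from has_integral_mult_right[OF integrable_integral[OF this], of 2]
    have I2: "(U has_integral 2 * (2 * pi * nev_proximity r (\<lambda>z. exp (h z)))) {0..2*pi}"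
      unfolding U_def nev_proximity_def by simp
    have "Re (L t) \<le> U t" for t
    proof -
      define x y where "x = h (of_real r * cis t)" "y = \<eta> * cis (- (real k * t))"
      have ny: "norm y = 1" by (simp add: x_y_def \<eta> norm_mult)
      have cy: "cnj y = cnj \<eta> * cis (real k * t)" by (simp add: x_y_def cis_cnj)
      have "L t = x + (x * y + x * cnj y) / 2" unfolding cy unfolding L_def x_y_def by (simp only: mult_ac)
      also have "\<dots> = x + x * (y + cnj y) / 2" by (simp add: distrib_left)
      also have "\<dots> = x * of_real (1 + Re y)" by (simp add: complex_add_cnj distrib_left)
      finally have e: "Re (L t) = Re x * (1 + Re y)" by simp
      have y2: "0 \<le> 1 + Re y" "1 + Re y \<le> 2" using abs_Re_le_cmod[of y] ny by auto
      have "Re x * (1 + Re y) \<le> max 0 (Re x) * (1 + Re y)" using y2 by (intro mult_right_mono) auto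
      also have "\<dots> \<le> max 0 (Re x) * 2" using y2 by (intro mult_left_mono) auto
      finally show ?thesis unfolding e U_def x_y_def by (simp add: log_plus_def mult.commute)
    qed
    then have "2 * pi * Re (h 0) + pi * r ^ k * norm A \<le> 2 * (2 * pi * nev_proximity r (\<lambda>z. exp (h z)))"
      using has_integral_le[OF I1 I2] by blast
    then have "pi * (r ^ k * norm A) \<le> pi * (4 * nev_proximity r (\<lambda>z. exp (h z)) - 2 * Re (h 0))"
      by (simp add: algebra_simps)
    then have "r ^ k * norm A \<le> 4 * nev_proximity r (\<lambda>z. exp (h z)) - 2 * Re (h 0)" by simp
    moreover have "r * norm A \<le> r ^ k * norm A"
      using r j by (intro mult_right_mono) (auto simp: self_le_power)
    ultimately have "r * norm A \<le> 4 * nev_proximity r (\<lambda>z. exp (h z)) - 2 * Re (h 0)" by linarith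
    then show ?thesis using r0 by (simp add: field_simps)
  qed
  have "((\<lambda>r. 4 * (nev_proximity r (\<lambda>z. exp (h z)) / r) - 2 * Re (h 0) / r) \<longlongrightarrow> 4 * 0 - 0) at_top"
    by (rule tendsto_diff[OF tendsto_mult[OF tendsto_const slow]
          real_tendsto_divide_at_top[OF tendsto_const filterlim_ident]])
  moreover have ev: "eventually (\<lambda>r. norm A \<le> 4 * (nev_proximity r (\<lambda>z. exp (h z)) / r) - 2 * Re (h 0) / r) at_top"
    using eventually_ge_at_top[of 1] by eventually_elim (rule bound)
  ultimately have "norm A \<le> 4 * 0 - 0"
    by (rule tendsto_lowerbound) (rule trivial_limit_at_top_linorder)
  then show "(deriv ^^ k) h 0 = 0" by (simp add: A_def)
qed (auto simp: connected_UNIV)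

lemma slow_entire_minus_linear:
  fixes g :: "complex \<Rightarrow> complex"
  assumes hol: "g holomorphic_on UNIV" and slow: "((\<lambda>r. nev_proximity r g / r) \<longlongrightarrow> 0) at_top"
  shows "((\<lambda>r. nev_proximity r (\<lambda>z. g z - \<alpha> * z - \<beta>) / r) \<longlongrightarrow> 0) at_top"
proof (rule tendsto_sandwich)
  have cont: "continuous_on UNIV g" using hol holomorphic_on_imp_continuous_on by blast
  then have cont': "continuous_on UNIV (\<lambda>z. g z - \<alpha> * z - \<beta>)" by (intro continuous_intros)
  define M where "M = norm \<alpha> + norm \<beta> + 1"
  show "eventually (\<lambda>r. 0 \<le> nev_proximity r (\<lambda>z. g z - \<alpha> * z - \<beta>) / r) at_top"
    using eventually_ge_at_top[of 1] by eventually_elim (auto intro!: divide_nonneg_nonneg nev_proximity_nonneg cont')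
  show "eventually (\<lambda>r. nev_proximity r (\<lambda>z. g z - \<alpha> * z - \<beta>) / r \<le>
         nev_proximity r g / r + ln r / r + (ln M + ln 2) / r) at_top"
    using eventually_ge_at_top[of 1]
  proof eventually_elim
    case (elim r)
    have M1: "M \<ge> 1" by (simp add: M_def)
    have "M * r \<ge> 1" using mult_mono[of 1 M 1 r] M1 elim by simp
    have "nev_proximity r (\<lambda>z. g z - \<alpha> * z - \<beta>) \<le> nev_proximity r g + log_plus (M * r) + ln 2"
    proof (rule nev_proximity_le_add[OF cont cont'])
      fix z :: complex assume z: "norm z = r"
      have "norm (g z - \<alpha> * z - \<beta>) \<le> norm (g z) + norm (\<alpha> * z) + norm \<beta>"
        using norm_triangle_ineq4[of "g z - \<alpha> * z" \<beta>] norm_triangle_ineq4[of "g z" "\<alpha> * z"] by linarith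
      moreover have "norm (\<alpha> * z) + norm \<beta> \<le> M * r"
        using elim mult_left_mono[of 1 r "norm \<beta>"] by (simp add: norm_mult z M_def distrib_right)
      ultimately show "norm (g z - \<alpha> * z - \<beta>) \<le> norm (g z) + M * r" by linarith
    qed (use elim M1 in auto)
    also have "log_plus (M * r) = ln M + ln r"
      using \<open>M * r \<ge> 1\<close> M1 elim by (simp add: log_plus_def ln_mult_pos)
    finally have "nev_proximity r (\<lambda>z. g z - \<alpha> * z - \<beta>) \<le> nev_proximity r g + ln r + (ln M + ln 2)"
      by simp
    then have "nev_proximity r (\<lambda>z. g z - \<alpha> * z - \<beta>) / r \<le> (nev_proximity r g + ln r + (ln M + ln 2)) / r"
      using elim by (intro divide_right_mono) auto
    then show ?case by (simp only: add_divide_distrib)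
  qed
  have "((\<lambda>r::real. ln r / r) \<longlongrightarrow> 0) at_top" by (rule ln_x_over_x_tendsto_0)
  then have "((\<lambda>r. nev_proximity r g / r + ln r / r + (ln M + ln 2) / r) \<longlongrightarrow> 0 + 0 + 0) at_top"
    by (rule tendsto_add[OF tendsto_add[OF slow] real_tendsto_divide_at_top[OF tendsto_const filterlim_ident]])
  then show "((\<lambda>r. nev_proximity r g / r + ln r / r + (ln M + ln 2) / r) \<longlongrightarrow> 0) at_top" by simp
qed simp

text \<open>
If \<open>\<kappa> = 1\<close>, subtracting \<open>\<beta> / c * z\<close> makes \<open>g\<close> periodic. Otherwise \<open>w \<mapsto> \<kappa> * w + \<beta>\<close> has a fixed point \<open>s\<close>, and \<open>g - s\<close>
is multiplied by \<open>\<kappa>\<close> under the shift. In both cases a zero recurs along a progression of step \<open>c\<close>.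
\<close>
lemma slow_entire_affine_shift:
  fixes g :: "complex \<Rightarrow> complex"
  assumes hol: "g holomorphic_on UNIV" and c: "c \<noteq> 0"
    and slow: "((\<lambda>r. nev_proximity r g / r) \<longlongrightarrow> 0) at_top"
    and shift: "\<And>z. g (z + c) = \<kappa> * g z + \<beta>"
  shows "if \<kappa> = 1 then \<forall>z. g z = \<beta> / c * z + g 0 else g constant_on UNIV"
proof (cases "\<kappa> = 1")
  case True
  define P where "P = (\<lambda>z. g z - \<beta> / c * z - g 0)"
  have hP: "P holomorphic_on UNIV" unfolding P_def by (intro holomorphic_intros hol) (use c in auto)
  have "P (0 + of_nat k * c) = 0" for k
  proof (induction k)
    case (Suc k)
    have "P (z + c) = P z" for z unfolding P_def shift True using c by (simp add: field_simps)
    from this[of "of_nat k * c"] Suc show ?case by (simp add: algebra_simps)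
  qed (simp add: P_def)
  then have P0: "P z = 0" for z
    by (rule slow_entire_zero_progression[OF hP c, where ?z1.0 = 0]) (unfold P_def, rule slow_entire_minus_linear[OF hol slow])
  have "g z = \<beta> / c * z + g 0" for z
  proof -
    have "g z - \<beta> / c * z - g 0 = 0" using P0[of z] by (simp only: P_def)
    then show ?thesis by (metis add.commute diff_add_cancel add_0)
  qed
  then have "\<forall>z. g z = \<beta> / c * z + g 0" by blast
  then show ?thesis unfolding if_P[OF True] .
next
  case False
  \<comment> \<open>The fixed point of \<open>w \<mapsto> \<kappa> * w + \<beta>\<close>.\<close>
  define s where "s = \<beta> / (1 - \<kappa>)"
  define G where "G = (\<lambda>z. g z - s)"
  have hG: "G holomorphic_on UNIV" unfolding G_def by (intro holomorphic_intros hol)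
  have slowG: "((\<lambda>r. nev_proximity r G / r) \<longlongrightarrow> 0) at_top"
    using slow_entire_minus_linear[OF hol slow, of 0 s] by (simp add: G_def)
  have "s = \<kappa> * s + \<beta>" using False unfolding s_def by (simp add: field_simps)
  then have sh: "G (z + c) = \<kappa> * G z" for z unfolding G_def shift by (simp add: algebra_simps)
  have "G constant_on UNIV"
  proof (cases "\<exists>z1. G z1 = 0")
    case True
    then obtain z1 where z1: "G z1 = 0" by blast
    have "G (z1 + of_nat k * c) = 0" for k
    proof (induction k)
      case (Suc k)
      then show ?case using sh[of "z1 + of_nat k * c"] by (simp add: algebra_simps)
    qed (simp add: z1)
    then have "G z = 0" for z by (rule slow_entire_zero_progression[OF hG c _ slowG])
    then show ?thesis by (auto simp: constant_on_def)
  next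
    case False
    then obtain h where h: "h holomorphic_on UNIV" "\<And>z. G z = exp (h z)"
      using contractible_imp_holomorphic_log[OF hG] by auto
    have h0: "h z = h 0" for z
      by (rule slow_exp_imp_constant[OF h(1)]) (use slowG h(2) in \<open>simp flip: h(2)\<close>)
    then have "G z = exp (h 0)" for z using h(2)[of z] h0[of z] by simp
    then show ?thesis by (auto simp: constant_on_def)
  qed
  then obtain k where "\<And>z. G z = k" by (auto simp: constant_on_def)
  then have "g z = k + s" for z by (simp add: G_def algebra_simps)
  then show ?thesis using False by (auto simp: constant_on_def)
qed

section \<open>The functional equation\<close>

theorem theorem3:
  fixes c :: complex and f g :: "complex \<Rightarrow> complex" and n m :: nat
  assumes "c \<noteq> 0"
    and "g holomorphic_on UNIV"
    and "f nicely_meromorphic_on UNIV"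
    and "\<not> f constant_on UNIV"
    and "n \<ge> 2" and "m \<ge> 3" and "(n, m) \<noteq> (3, 3)"
  shows "(solves_fermat_shift n m c g f \<longleftrightarrow>
           (\<exists>A B l. A \<noteq> 0 \<and> B \<noteq> 0 \<and> A ^ n + B ^ m = 1 \<and> exp l = B / A \<and>
              (\<forall>z. f z = A * exp (g z / of_nat n)) \<and>
              (\<forall>z. g (z + c) = of_nat n / of_nat m * g z + of_nat n * l)))
       \<and> (nev_order g < 1 \<longrightarrow>
           (solves_fermat_shift n m c g f \<longleftrightarrow>
             n = m \<and>
             (\<exists>\<alpha> \<beta> A. \<alpha> \<noteq> 0 \<and> A ^ n * (1 + exp (\<alpha> * c)) = 1 \<and>
                (\<forall>z. g z = \<alpha> * z + \<beta>) \<and>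
                (\<forall>z. f z = A * exp ((\<alpha> * z + \<beta>) / of_nat n)))))"
    (is "(?sol \<longleftrightarrow> (\<exists>A B l. ?cond A B l)) \<and> (_ \<longrightarrow> (_ \<longleftrightarrow> ?lin))")
proof -
  have n0: "of_nat n \<noteq> (0 :: complex)" and m0: "of_nat m \<noteq> (0 :: complex)" using assms by auto
  have expn: "exp (x / of_nat k) ^ k = exp x" if "k > 0" for x :: complex and k
    using that by (simp flip: exp_of_nat_mult)
  have forward: "\<exists>A B l. ?cond A B l" if sol: ?sol
  proof -
    obtain A B where AB: "A \<noteq> 0" "B \<noteq> 0" "A ^ n + B ^ m = 1"
      "\<And>z. f z = A * exp (g z / of_nat n)" "\<And>z. f (z + c) = B * exp (g z / of_nat m)"
      using fermat_shift_constants[OF assms(2-7) sol] by blast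
    define \<phi> where "\<phi> = (\<lambda>z. g (z + c) / of_nat n - g z / of_nat m)"
    have \<phi>: "\<phi> holomorphic_on UNIV" unfolding \<phi>_def
      by (intro holomorphic_intros assms(2) holomorphic_on_translate) (use n0 m0 in auto)
    have e: "exp (\<phi> z) = B / A" for z
      using AB(4)[of "z + c"] AB(5)[of z] AB(1) unfolding \<phi>_def exp_diff by (simp add: field_simps)
    have const: "\<phi> z = \<phi> 0" for z by (rule entire_exp_constant_imp_constant[OF \<phi> e])
    have "g (z + c) = of_nat n / of_nat m * g z + of_nat n * \<phi> 0" for z
    proof -
      have "g (z + c) / of_nat n = g z / of_nat m + \<phi> 0"
        using const[of z] fun_cong[OF \<phi>_def, of z] by (metis add.commute diff_add_cancel)
      then have "of_nat n * (g (z + c) / of_nat n) = of_nat n * (g z / of_nat m + \<phi> 0)" by (rule arg_cong)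
      then show ?thesis using n0 by (simp add: distrib_left)
    qed
    then show ?thesis using AB e[of 0] by blast
  qed
  have backward: ?sol if cond: "?cond A B l" for A B l
    unfolding solves_fermat_shift_def
  proof (intro allI impI)
    fix z
    have fz: "f z = A * exp (g z / of_nat n)" for z using cond by blast
    have "g (z + c) = of_nat n / of_nat m * g z + of_nat n * l" using cond by blast
    then have "g (z + c) / of_nat n = g z / of_nat m + l" using n0 by (simp add: add_divide_distrib)
    then have "f (z + c) = A * exp l * exp (g z / of_nat m)" unfolding fz by (simp add: exp_add)
    also have "A * exp l = B" using cond by simp
    finally have "f z ^ n + f (z + c) ^ m = (A ^ n + B ^ m) * exp (g z)"
      unfolding fz using expn assms(5,6) by (simp add: power_mult_distrib distrib_right)
    then show "f z ^ n + f (z + c) ^ m = exp (g z)" using cond by simp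
  qed
  have linear: ?lin if sol: ?sol and ord: "nev_order g < 1"
  proof -
    obtain A B l where ABl: "?cond A B l" using forward[OF sol] by blast
    have nonconst: "\<not> g constant_on UNIV"
    proof
      assume "g constant_on UNIV"
      then obtain k where "\<And>z. g z = k" by (auto simp: constant_on_def)
      then have "f z = A * exp (k / of_nat n)" for z using ABl by simp
      then show False using assms(4) by (auto simp: constant_on_def)
    qed
    have dich: "if of_nat n / of_nat m = (1::complex) then \<forall>z. g z = of_nat n * l / c * z + g 0 else g constant_on UNIV"
      by (rule slow_entire_affine_shift[OF assms(2,1) nev_order_less_1_imp_slow[OF assms(2) ord]])
         (use ABl in blast)
    have one: "of_nat n / of_nat m = (1::complex)"
      using dich nonconst by (meson if_not_P)
    then have nm: "n = m" using m0 by simp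
    have gz: "g z = of_nat n * l / c * z + g 0" for z
      using dich unfolding if_P[OF one] by blast
    define \<alpha> where "\<alpha> = of_nat n * l / c"
    have "\<alpha> \<noteq> 0" using nonconst gz unfolding \<alpha>_def constant_on_def by (metis mult_zero_left add_0)
    moreover have "A ^ n * (1 + exp (\<alpha> * c)) = 1"
    proof -
      have "exp (\<alpha> * c) = exp l ^ n" unfolding \<alpha>_def using assms(1) by (simp flip: exp_of_nat_mult)
      also have "\<dots> = B ^ n / A ^ n" using ABl by (simp add: power_divide)
      finally show ?thesis using ABl nm by (simp add: distrib_left)
    qed
    moreover have "\<forall>z. f z = A * exp ((\<alpha> * z + g 0) / of_nat n)"
      using ABl gz unfolding \<alpha>_def by metis
    ultimately show ?thesis using nm gz unfolding \<alpha>_def by blast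
  qed
  have linear_back: ?sol if lin: ?lin
  proof -
    obtain \<alpha> \<beta> A where L: "A ^ n * (1 + exp (\<alpha> * c)) = 1" "\<And>z. g z = \<alpha> * z + \<beta>"
        "\<And>z. f z = A * exp ((\<alpha> * z + \<beta>) / of_nat n)" and nm: "n = m" using lin by blast
    have "f z ^ n + f (z + c) ^ m = exp (g z)" for z
    proof -
      have "f z ^ n + f (z + c) ^ m = A ^ n * exp (\<alpha> * z + \<beta>) + A ^ n * exp (\<alpha> * (z + c) + \<beta>)"
        unfolding L(3) nm[symmetric] power_mult_distrib using expn assms(5) by simp
      also have "\<alpha> * (z + c) + \<beta> = (\<alpha> * z + \<beta>) + \<alpha> * c" by (simp add: algebra_simps)
      also have "A ^ n * exp (\<alpha> * z + \<beta>) + A ^ n * exp ((\<alpha> * z + \<beta>) + \<alpha> * c)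
          = (A ^ n * (1 + exp (\<alpha> * c))) * exp (\<alpha> * z + \<beta>)"
        unfolding exp_add[of "\<alpha> * z + \<beta>"] by (simp add: algebra_simps)
      finally show ?thesis using L by simp
    qed
    then show ?thesis unfolding solves_fermat_shift_def by blast
  qed
  show ?thesis using forward backward linear linear_back by blast
qed

end
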